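(* Let $\bar A=(A_0,A_1)$ be a compatible couple of (quasi-)Banach spaces with $A_0\cap A_1\neq\{0\}$. Let $0<q_1,r_1\le\infty$ and $a_1,b_1\in SV$ be such that $\|s^{-1/r_1}b_1(s)\|_{r_1,(1,\infty)}<\infty$ and $\left\|s^{-1/r_1}b_1(s)\|u^{-1/q_1}a_1(u)\|_{q_1,(0,s)}\right\|_{r_1,(0,1)}<\infty$, and put $$\chi_1(t)=\left\|s^{-1/r_1}b_1(s)\|u^{-1/q_1}a_1(u)\|_{q_1,(0,s)}\right\|_{r_1,(0,t)}+\|s^{-1/r_1}b_1(s)\|_{r_1,(t,\infty)}\|u^{-1/q_1}a_1(u)\|_{q_1,(0,t)}.$$ Let $0<\theta_0<1$, $0<r_0\le\infty$, and $b_0\in SV$. Put $\rho(t)=t^{1-\theta_0}\frac{b_0(t)}{\chi_1(t)}$. Then, for all $f\in\bar A_{\theta_0,r_0,b_0}+\bar A^{\mathcal L}_{1,r_1,b_1,q_1,a_1}$ and $t>0$, $$K\left(\rho(t),f;\bar A_{\theta_0,r_0,b_0},\bar A^{\mathcal L}_{1,r_1,b_1,q_1,a_1}\right)\approx\|u^{-\theta_0-1/r_0}b_0(u)K(u,f)\|_{r_0,(0,t)}+\rho(t)\left\|s^{-1/r_1}b_1(s)\|u^{-1-1/q_1}a_1(u)K(u,f)\|_{q_1,(t,s)}\right\|_{r_1,(t,\infty)},$$ with equivalence constants independent of $f$ and $t$.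
   Context: Conventions: $1/\infty=0$; $\|\cdot\|_{q,(a,b)}$ is the usual (quasi-)norm of $L_q$ on the interval $(a,b)$, $0<q\le\infty$. $F\approx G$ means $C^{-1}G\le F\le CG$ for some constant $C>0$ independent of all significant quantities. $b\in SV$ (slowly varying) means that $b$ is a positive Lebesgue measurable function on $(0,\infty)$ such that for each $\varepsilon>0$ the function $t^{\varepsilon}b(t)$ is equivalent ($\approx$) to an increasing function and $t^{-\varepsilon}b(t)$ is equivalent to a decreasing function. For a compatible couple $(X_0,X_1)$ of (quasi-)normed spaces, $K(t,f;X_0,X_1)=\inf\{\|f_0\|_{X_0}+t\|f_1\|_{X_1}: f=f_0+f_1,\ f_i\in X_i\}$ for $f\in X_0+X_1$, $t>0$; $K(t,f):=K(t,f;A_0,A_1)$. For $0\le\theta\le1$, $0<r,q\le\infty$, $a,b\in SV$, the following are the spaces of all $f\in A_0+A_1$ with finite (quasi-)norm: $\bar A_{\theta,q,b}$: $\|u^{-\theta-1/q}b(u)K(u,f)\|_{q,(0,\infty)}$; $\bar A^{\mathcal L}_{\theta,r,b,q,a}$: $\left\|t^{-1/r}b(t)\|u^{-\theta-1/q}a(u)K(u,f)\|_{q,(0,t)}\right\|_{r,(0,\infty)}$. Standing assumption: none of the spaces under consideration is $\{0\}$. *)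

theory Defs
  imports "HOL-Analysis.Analysis" "HOL-Probability.Essential_Supremum"
begin

text \<open>
  Scalars are real; complex spaces are covered by restriction of scalars, since only the
  quasi-norms enter the K-functional.
\<close>

record 'v qn_space =
  carr :: "'v set"
  qnorm :: "'v \<Rightarrow> real"

definition quasi_normed :: "'v::real_vector qn_space \<Rightarrow> bool" where
  "quasi_normed X \<longleftrightarrow>
     subspace (carr X) \<and>
     (\<forall>x\<in>carr X. 0 \<le> qnorm X x \<and> (qnorm X x = 0 \<longleftrightarrow> x = 0)) \<and>
     (\<forall>x\<in>carr X. \<forall>c. qnorm X (c *\<^sub>R x) = \<bar>c\<bar> * qnorm X x) \<and>
     (\<exists>C\<ge>1. \<forall>x\<in>carr X. \<forall>y\<in>carr X. qnorm X (x + y) \<le> C * (qnorm X x + qnorm X y))"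

definition quasi_banach :: "'v::real_vector qn_space \<Rightarrow> bool" where
  "quasi_banach X \<longleftrightarrow> quasi_normed X \<and>
     (\<forall>\<sigma>::nat \<Rightarrow> 'v. (\<forall>n. \<sigma> n \<in> carr X) \<longrightarrow>
        (\<forall>e>0. \<exists>N. \<forall>m\<ge>N. \<forall>n\<ge>N. qnorm X (\<sigma> m - \<sigma> n) < e) \<longrightarrow>
        (\<exists>x\<in>carr X. (\<lambda>n. qnorm X (\<sigma> n - x)) \<longlonglongrightarrow> 0))"

text \<open>Continuity of the inclusion map into the ambient space.\<close>

definition continuously_embedded ::
    "'v::{real_vector, topological_ab_group_add} qn_space \<Rightarrow> bool" where
  "continuously_embedded X \<longleftrightarrow>
     (\<forall>x\<in>carr X. \<forall>U. open U \<and> x \<in> U \<longrightarrow>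
        (\<exists>d>0. \<forall>y\<in>carr X. qnorm X (y - x) < d \<longrightarrow> y \<in> U))"

text \<open>
  The ambient Hausdorff topological vector space is the whole type; the sort provides everything
  except joint continuity of scalar multiplication.
\<close>

definition compatible_couple ::
    "'v::{real_vector, topological_ab_group_add, t2_space} qn_space \<Rightarrow> 'v qn_space \<Rightarrow> bool" where
  "compatible_couple X Y \<longleftrightarrow>
     continuous_on UNIV (\<lambda>(c::real, x::'v). c *\<^sub>R x) \<and>
     quasi_normed X \<and> quasi_normed Y \<and> continuously_embedded X \<and> continuously_embedded Y"

definition sum_carr :: "'v::real_vector qn_space \<Rightarrow> 'v qn_space \<Rightarrow> 'v set" where
  "sum_carr X Y = {x + y | x y. x \<in> carr X \<and> y \<in> carr Y}"

text \<open>Finite for \<open>f\<close> in \<open>sum_carr X Y\<close> and \<open>\<infinity>\<close> (infimum of the empty set) otherwise.\<close>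

definition K_fun :: "real \<Rightarrow> 'v::real_vector \<Rightarrow> 'v qn_space \<Rightarrow> 'v qn_space \<Rightarrow> ennreal" where
  "K_fun t f X Y =
     Inf {ennreal (qnorm X x + t * qnorm Y y) | x y. x \<in> carr X \<and> y \<in> carr Y \<and> f = x + y}"

text \<open>Power with positive exponent, extended by \<open>\<infinity> powr p = \<infinity>\<close>.\<close>

definition epowr :: "ennreal \<Rightarrow> real \<Rightarrow> ennreal" where
  "epowr x p = (if x = \<infinity> then \<infinity> else ennreal (enn2real x powr p))"

text \<open>
  The functions to which this is applied are nonnegative, measurable and possibly
  infinite-valued (such as inner quasi-norms of iterated expressions).
\<close>

definition Lq_norm :: "ennreal \<Rightarrow> real set \<Rightarrow> (real \<Rightarrow> ennreal) \<Rightarrow> ennreal" where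
  "Lq_norm q S f =
     (if q = \<infinity> then esssup (lebesgue_on S) f
      else epowr (\<integral>\<^sup>+ x. epowr (f x) (enn2real q) \<partial>lebesgue_on S) (1 / enn2real q))"

text \<open>The real number \<open>1/q\<close>, with \<open>1/\<infinity> = 0\<close>.\<close>

definition recip :: "ennreal \<Rightarrow> real" where
  "recip q = enn2real (1 / q)"

definition equivalent_on :: "real set \<Rightarrow> (real \<Rightarrow> real) \<Rightarrow> (real \<Rightarrow> real) \<Rightarrow> bool" where
  "equivalent_on S F G \<longleftrightarrow> (\<exists>C>0. \<forall>t\<in>S. (1 / C) * G t \<le> F t \<and> F t \<le> C * G t)"

definition SV :: "(real \<Rightarrow> real) set" where
  "SV = {b. (\<forall>t>0. 0 < b t) \<and> b \<in> borel_measurable (lebesgue_on {0<..}) \<and>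
     (\<forall>e>0.
        (\<exists>g. mono_on {0<..} g \<and> equivalent_on {0<..} (\<lambda>t. t powr e * b t) g) \<and>
        (\<exists>h. antimono_on {0<..} h \<and> equivalent_on {0<..} (\<lambda>t. t powr (- e) * b t) h))}"

text \<open>
  The quasi-norm of \<open>u powr (- \<theta> - 1/q) * b u * F u\<close> in \<open>Lq\<close> over \<open>S\<close>; all weighted and
  iterated quasi-norms below are instances (with \<open>\<theta> = 0\<close> for the outer ones).
\<close>

definition wnorm ::
    "real \<Rightarrow> ennreal \<Rightarrow> (real \<Rightarrow> real) \<Rightarrow> real set \<Rightarrow> (real \<Rightarrow> ennreal) \<Rightarrow> ennreal" where
  "wnorm \<theta> q b S F = Lq_norm q S (\<lambda>u. ennreal (u powr (- \<theta> - recip q) * b u) * F u)"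

definition space_with_norm ::
    "'v::real_vector qn_space \<Rightarrow> 'v qn_space \<Rightarrow> ('v \<Rightarrow> ennreal) \<Rightarrow> 'v qn_space" where
  "space_with_norm A0 A1 N =
     \<lparr> carr = {f \<in> sum_carr A0 A1. N f < \<infinity>}, qnorm = (\<lambda>f. enn2real (N f)) \<rparr>"

definition interp ::
    "'v::real_vector qn_space \<Rightarrow> 'v qn_space \<Rightarrow> real \<Rightarrow> ennreal \<Rightarrow> (real \<Rightarrow> real) \<Rightarrow> 'v qn_space" where
  "interp A0 A1 \<theta> q b =
     space_with_norm A0 A1 (\<lambda>f. wnorm \<theta> q b {0<..} (\<lambda>u. K_fun u f A0 A1))"

definition interp_L ::
    "'v::real_vector qn_space \<Rightarrow> 'v qn_space \<Rightarrow> real \<Rightarrow> ennreal \<Rightarrow> (real \<Rightarrow> real) \<Rightarrow>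
      ennreal \<Rightarrow> (real \<Rightarrow> real) \<Rightarrow> 'v qn_space" where
  "interp_L A0 A1 \<theta> r b q a =
     space_with_norm A0 A1
       (\<lambda>f. wnorm 0 r b {0<..} (\<lambda>t. wnorm \<theta> q a {0<..<t} (\<lambda>u. K_fun u f A0 A1)))"

definition chi ::
    "ennreal \<Rightarrow> (real \<Rightarrow> real) \<Rightarrow> ennreal \<Rightarrow> (real \<Rightarrow> real) \<Rightarrow> real \<Rightarrow> ennreal" where
  "chi r b q a t =
     wnorm 0 r b {0<..<t} (\<lambda>s. wnorm 0 q a {0<..<s} (\<lambda>u. 1)) +
     wnorm 0 r b {t<..} (\<lambda>s. 1) * wnorm 0 q a {0<..<t} (\<lambda>u. 1)"

text \<open>
  Under the integrability conditions on \<open>a\<close> and \<open>b\<close> in the theorem, \<open>chi\<close> is finite and positive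
  for all \<open>t > 0\<close>, so that \<open>enn2real\<close> loses nothing.
\<close>

definition rho ::
    "real \<Rightarrow> (real \<Rightarrow> real) \<Rightarrow> ennreal \<Rightarrow> (real \<Rightarrow> real) \<Rightarrow> ennreal \<Rightarrow> (real \<Rightarrow> real) \<Rightarrow> real \<Rightarrow> real" where
  "rho \<theta> b0 r b q a t = t powr (1 - \<theta>) * b0 t / enn2real (chi r b q a t)"

end

theory Submission
  imports Defs
begin

text \<open>
  Let \<open>X\<close> be the classical space with parameters \<open>\<theta>0, r0, b0\<close> and \<open>Y\<close> the limiting space with
  parameters \<open>r1, b1, q1, a1\<close>, and let \<open>I(t, f)\<close> and \<open>J(t, f)\<close> be the two quasi-norms on the right
  of the formula: the part of the quasi-norm of \<open>X\<close> that lives on \<open>(0,t)\<close>, and the part of the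
  quasi-norm of \<open>Y\<close> that lives on \<open>(t,\<infinity>)\<close>.  The proof follows Holmstedt.  It uses only that
  \<open>k(u) = K(u, f)\<close> is quasi-concave (\<open>k\<close> increases, \<open>k(u)/u\<close> decreases), that \<open>K\<close> is quasi-subadditive
  in \<open>f\<close>, and that slowly varying functions obey Potter bounds
  \<open>b(t) \<le> C (t/u)\<^sup>\<epsilon> b(u)\<close> and \<open>b(u) \<le> C (t/u)\<^sup>\<epsilon> b(t)\<close> for \<open>u \<le> t\<close>.

  Upper bound.  Take \<open>f = x + y\<close> almost optimal for \<open>K(t, f)\<close>.  Then \<open>K(u, x)\<close> is at most a constant
  times \<open>k(min u t)\<close>, while \<open>K(u, y)\<close> is at most a constant times \<open>u k(t)/t\<close> for \<open>u \<le> t\<close> and times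
  \<open>k(u)\<close> for \<open>u > t\<close>.  So the quasi-norm of \<open>x\<close> in \<open>X\<close> is controlled by
  \<open>I(t, f) + t powr (- \<theta>0) * b0(t) k(t)\<close>, and that of \<open>y\<close> in \<open>Y\<close> by \<open>\<chi>1(t) k(t)/t + J(t, f)\<close>; the number
  \<open>\<chi>1(t)\<close> is precisely what the \<open>Y\<close>-quasi-norm makes of a linear piece on \<open>(0,t)\<close>.  The factor
  \<open>\<rho>(t)\<close> is chosen so that \<open>\<rho>(t) \<chi>1(t) k(t)/t = t powr (- \<theta>0) * b0(t) k(t)\<close>, and quasi-concavity
  bounds this number by \<open>I(t, f)\<close> (\<open>X_on_truncation_le\<close>, \<open>Y_from_truncation_le\<close>).

  Lower bound.  Let \<open>f = g + h\<close> with \<open>g \<in> X\<close>, \<open>h \<in> Y\<close>.  Clearly \<open>I(t, g)\<close> and \<open>J(t, h)\<close> are at most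
  the full quasi-norms, so only the cross terms matter.  Quasi-concavity turns the two quasi-norms
  into pointwise bounds, \<open>K(u, h) \<le> 2 u/\<chi>1(u)\<close> times the quasi-norm of \<open>h\<close> and
  \<open>K(u, g) \<le> C u powr \<theta>0 / b0(u)\<close> times the quasi-norm of \<open>g\<close>.  Inserting the first into \<open>I(t, h)\<close>
  leaves the quasi-norm of \<open>u powr (1 - \<theta>0) * b0(u)/\<chi>1(u)\<close> on \<open>(0,t)\<close>, which is of order \<open>\<rho>(t)\<close>
  because \<open>\<chi>1\<close> again satisfies a Potter bound (\<open>X_on_le_Y_from\<close>).  Inserting the second into
  \<open>J(t, g)\<close> leaves a tail of \<open>u powr (\<theta>0 - 1) * a1(u)/b0(u)\<close>, of order
  \<open>t powr (\<theta>0 - 1) * a1(t)/b0(t)\<close>; multiplied by \<open>\<rho>(t)\<close> this is bounded, since \<open>a1(t)\<close> is dominated by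
  the quasi-norm of \<open>a1\<close> on \<open>(0,t)\<close>, which occurs in the second summand of \<open>\<chi>1(t)\<close>
  (\<open>Y_from_le_X_on\<close>).
\<close>

section \<open>Quasi-norms of extended nonnegative functions\<close>


lemma epowr_mono: "0 \<le> p \<Longrightarrow> x \<le> y \<Longrightarrow> epowr x p \<le> epowr y p"
  unfolding epowr_def
  by (auto simp: top_unique less_top intro!: ennreal_leI powr_mono2 enn2real_mono)

lemma epowr_mult:
  assumes "0 < p" shows "epowr (x * y) p = epowr x p * epowr y p"
proof (cases "x = \<infinity> \<or> y = \<infinity>")
  case True
  have *: "epowr (\<infinity> * z) p = epowr \<infinity> p * epowr z p" for z
    using assms
    by (cases z) (auto simp: epowr_def ennreal_top_mult)
  show ?thesis using True *[of y] *[of x] by (auto simp: mult.commute)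
next
  case False
  then obtain a b where "x = ennreal a" "y = ennreal b" "a \<ge> 0" "b \<ge> 0"
    by (cases x; cases y) auto
  then show ?thesis by (simp add: epowr_def flip: ennreal_mult) (simp add: powr_mult)
qed

lemma epowr_inverse [simp]:
  assumes "0 < p" shows "epowr (epowr x p) (1 / p) = x"
  using assms by (cases x) (auto simp: epowr_def powr_powr)

lemma epowr_zero [simp]: "epowr 0 p = 0"
  by (simp add: epowr_def)

text \<open>
  Splitting \<open>x + y \<le> 2 max x y\<close> covers \<open>p < 1\<close> and \<open>p \<ge> 1\<close> alike; since only equivalence of
  quasi-norms is at stake, the crude constant is harmless.
\<close>

lemma epowr_add_le:
  assumes "0 < p"
  shows "epowr (x + y) p \<le> ennreal (2 powr p) * (epowr x p + epowr y p)"
proof -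
  have "x + y \<le> ennreal 2 * max x y"
    by (simp add: mult_2 add_mono)
  then have "epowr (x + y) p \<le> epowr (ennreal 2 * max x y) p"
    using assms by (intro epowr_mono) auto
  also have "\<dots> = ennreal (2 powr p) * epowr (max x y) p"
    using assms by (simp add: epowr_mult) (simp add: epowr_def)
  also have "\<dots> \<le> ennreal (2 powr p) * (epowr x p + epowr y p)"
    by (intro mult_left_mono) (auto simp: max_def)
  finally show ?thesis .
qed

lemma borel_measurable_epowr [measurable (raw)]:
  assumes [measurable]: "f \<in> borel_measurable M"
  shows "(\<lambda>x. epowr (f x) p) \<in> borel_measurable M"
  unfolding epowr_def by measurable

lemma epowr_less_top [simp]: "epowr x p < \<infinity> \<longleftrightarrow> x < \<infinity>"
  by (auto simp: epowr_def less_top)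

lemma lebesgue_on_UNIV [simp]: "lebesgue_on UNIV = lebesgue"
  by (rule lebesgue_on_UNIV_eq)

text \<open>
  This moves all quasi-norms to one measure space, so that different intervals can be compared.
\<close>

lemma Lq_norm_indicator:
  assumes S: "S \<in> sets lebesgue" and q: "0 < q"
  shows "Lq_norm q S f = Lq_norm q UNIV (\<lambda>x. f x * indicator S x)"
proof (cases "q = \<infinity>")
  case True
  have m: "f \<in> borel_measurable (lebesgue_on S) \<longleftrightarrow> (\<lambda>x. f x * indicator S x) \<in> borel_measurable lebesgue"
    using S by (intro borel_measurable_restrict_space_iff_ennreal) auto
  have "(AE x in lebesgue_on S. f x \<le> z) \<longleftrightarrow> (AE x in lebesgue. f x * indicator S x \<le> z)" for z
    using S by (subst AE_restrict_space_iff) (auto intro!: AE_cong simp: indicator_def)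
  then have "esssup (lebesgue_on S) f = esssup lebesgue (\<lambda>x. f x * indicator S x)"
    by (cases "f \<in> borel_measurable (lebesgue_on S)")
       (use m in \<open>auto simp: esssup_eq_AE esssup_non_measurable\<close>)
  then show ?thesis using True by (simp add: Lq_norm_def)
next
  case False
  have "epowr (f x * indicator S x) p = epowr (f x) p * indicator S x" for x p
    by (simp add: indicator_def)
  then show ?thesis using False S by (simp add: Lq_norm_def nn_integral_restrict_space)
qed

lemma Lq_norm_mono_AE:
  assumes "f \<in> borel_measurable lebesgue" and "AE x in lebesgue. f x \<le> g x"
  shows "Lq_norm q UNIV f \<le> Lq_norm q UNIV g"
  using assms unfolding Lq_norm_def
  by (auto intro!: esssup_AE_mono epowr_mono nn_integral_mono_AE)

lemma enn2real_pos: "0 < q \<Longrightarrow> q \<noteq> \<infinity> \<Longrightarrow> 0 < enn2real q"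
  by (simp add: enn2real_positive_iff less_top)

lemma Lq_norm_cmult_le:
  assumes [measurable]: "f \<in> borel_measurable lebesgue" and q: "0 < q"
  shows "Lq_norm q UNIV (\<lambda>x. c * f x) \<le> c * Lq_norm q UNIV f"
proof (cases "q = \<infinity>")
  case True
  have "AE x in lebesgue. c * f x \<le> c * esssup lebesgue f"
    using esssup_AE[of f lebesgue] by eventually_elim (simp add: mult_left_mono)
  then show ?thesis using True by (auto simp: Lq_norm_def intro!: esssup_I)
next
  case False
  have p: "0 < enn2real q" using q False by (rule enn2real_pos)
  show ?thesis using False p
    by (simp add: Lq_norm_def epowr_mult nn_integral_cmult)
qed

lemma Lq_norm_add_le:
  assumes q: "0 < q"
  shows "\<exists>C<\<infinity>. \<forall>f\<in>borel_measurable lebesgue. \<forall>g\<in>borel_measurable lebesgue.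
    Lq_norm q UNIV (\<lambda>x. f x + g x) \<le> C * (Lq_norm q UNIV f + Lq_norm q UNIV g)"
proof (cases "q = \<infinity>")
  case True
  have "esssup lebesgue (\<lambda>x. f x + g x) \<le> esssup lebesgue f + esssup lebesgue g"
    if [measurable]: "f \<in> borel_measurable lebesgue" "g \<in> borel_measurable lebesgue"
    for f g :: "real \<Rightarrow> ennreal"
  proof (rule esssup_I)
    show "AE x in lebesgue. f x + g x \<le> esssup lebesgue f + esssup lebesgue g"
      using esssup_AE[of f lebesgue] esssup_AE[of g lebesgue]
      by eventually_elim (simp add: add_mono)
  qed simp
  then show ?thesis using True by (intro exI[of _ 1]) (simp add: Lq_norm_def)
next
  case False
  define p where "p = enn2real q"
  have p: "0 < p" using q False by (simp add: enn2real_pos p_def)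
  define C where "C = ennreal (2 powr (1 / p)) * ennreal 2"
  have "epowr (\<integral>\<^sup>+x. epowr (f x + g x) p \<partial>lebesgue) (1/p)
      \<le> C * (epowr (\<integral>\<^sup>+x. epowr (f x) p \<partial>lebesgue) (1/p) + epowr (\<integral>\<^sup>+x. epowr (g x) p \<partial>lebesgue) (1/p))"
    if [measurable]: "f \<in> borel_measurable lebesgue" "g \<in> borel_measurable lebesgue"
    for f g :: "real \<Rightarrow> ennreal"
  proof -
    let ?F = "\<integral>\<^sup>+x. epowr (f x) p \<partial>lebesgue" and ?G = "\<integral>\<^sup>+x. epowr (g x) p \<partial>lebesgue"
    have "(\<integral>\<^sup>+x. epowr (f x + g x) p \<partial>lebesgue)
        \<le> (\<integral>\<^sup>+x. ennreal (2 powr p) * (epowr (f x) p + epowr (g x) p) \<partial>lebesgue)"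
      using p by (intro nn_integral_mono epowr_add_le)
    also have "\<dots> = ennreal (2 powr p) * (?F + ?G)"
      by (simp add: nn_integral_cmult nn_integral_add)
    finally have "epowr (\<integral>\<^sup>+x. epowr (f x + g x) p \<partial>lebesgue) (1/p)
        \<le> epowr (ennreal (2 powr p) * (?F + ?G)) (1/p)"
      using p by (intro epowr_mono) auto
    also have "\<dots> = ennreal 2 * epowr (?F + ?G) (1/p)"
      using p by (simp add: epowr_mult) (simp add: epowr_def powr_powr)
    also have "\<dots> \<le> ennreal 2 * (ennreal (2 powr (1/p)) * (epowr ?F (1/p) + epowr ?G (1/p)))"
      using p by (intro mult_left_mono epowr_add_le) auto
    finally show ?thesis by (simp add: C_def mult_ac)
  qed
  then show ?thesis using False unfolding Lq_norm_def
    by (intro exI[of _ C]) (simp add: C_def p_def ennreal_mult_less_top)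
qed

section \<open>Quasi-norms with respect to the dilation-invariant measure\<close>

text \<open>
  The \<open>Lq\<close> quasi-norm for the dilation-invariant measure \<open>du/u\<close>, into which the factor
  \<open>u powr (- recip q)\<close> of all weighted quasi-norms is absorbed; for \<open>q = \<infinity>\<close> that factor is \<open>1\<close> on the
  half-line.
\<close>

definition haar_norm :: "ennreal \<Rightarrow> real set \<Rightarrow> (real \<Rightarrow> ennreal) \<Rightarrow> ennreal" where
  "haar_norm q S G = Lq_norm q S (\<lambda>u. ennreal (u powr (- recip q)) * G u)"

text \<open>
  Measurability has to be carried along: sums of quasi-norms are estimated by additivity of the integral,
  and \<open>esssup\<close> is infinite on functions that are not measurable.
\<close>

definition measurable_pos :: "(real \<Rightarrow> ennreal) \<Rightarrow> bool" where
  "measurable_pos G \<longleftrightarrow> G \<in> borel_measurable (lebesgue_on {0<..})"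

lemma measurable_pos_mult [intro]:
  "measurable_pos F \<Longrightarrow> measurable_pos G \<Longrightarrow> measurable_pos (\<lambda>u. F u * G u)"
  and measurable_pos_add [intro]:
  "measurable_pos F \<Longrightarrow> measurable_pos G \<Longrightarrow> measurable_pos (\<lambda>u. F u + G u)"
  and measurable_pos_const [intro]: "measurable_pos (\<lambda>u. c)"
  by (auto simp: measurable_pos_def)

lemma measurable_pos_indicator [intro]:
  "S \<in> sets borel \<Longrightarrow> measurable_pos (indicator S)"
  unfolding measurable_pos_def
  by (intro measurable_restrict_space1 borel_measurable_indicator) auto

lemma measurable_pos_borel [intro]:
  "f \<in> borel_measurable borel \<Longrightarrow> measurable_pos (\<lambda>u. ennreal (f u))"
  unfolding measurable_pos_def
  by (intro measurable_restrict_space1 measurable_completion) auto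

lemma measurable_pos_mono:
  assumes "mono (F :: real \<Rightarrow> ennreal)"
  shows "measurable_pos F"
proof -
  have "F \<in> borel_measurable borel"
  proof (rule borel_measurableI_greater)
    fix y
    have "is_interval {x. y < F x}"
      using assms unfolding is_interval_1 mono_def by (auto intro: less_le_trans)
    then have "{x. y < F x} \<in> sets borel"
      by (rule real_interval_borel_measurable)
    then show "{x \<in> space borel. y < F x} \<in> sets borel" by simp
  qed
  then show ?thesis unfolding measurable_pos_def
    by (intro measurable_restrict_space1 measurable_completion) auto
qed

lemma haar_integrand_measurable:
  assumes "measurable_pos G" and "S \<in> sets borel" and "S \<subseteq> {0<..}"
  shows "(\<lambda>u. ennreal (u powr p) * G u * indicator S u) \<in> borel_measurable lebesgue"
proof -
  have 1: "(\<lambda>u. G u * indicator {0<..} u) \<in> borel_measurable lebesgue"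
    using assms(1) unfolding measurable_pos_def
    by (subst (asm) borel_measurable_restrict_space_iff_ennreal) auto
  have 2: "(\<lambda>u. ennreal (u powr p) * indicator S u) \<in> borel_measurable lebesgue"
    by (intro measurable_completion) (use assms(2) in measurable)
  have "(\<lambda>u. (G u * indicator {0<..} u) * (ennreal (u powr p) * indicator S u)) \<in> borel_measurable
      lebesgue"
    using 1 2 by (rule borel_measurable_times_ennreal)
  also have "(\<lambda>u. (G u * indicator {0<..} u) * (ennreal (u powr p) * indicator S u))
     = (\<lambda>u. ennreal (u powr p) * G u * indicator S u)"
    using assms(3) by (auto simp: indicator_def fun_eq_iff mult_ac)
  finally show ?thesis .
qed

lemma haar_norm_UNIV:
  assumes "0 < q" and "S \<in> sets borel"
  shows "haar_norm q S G = Lq_norm q UNIV (\<lambda>u. ennreal (u powr (- recip q)) * G u * indicator S u)"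
  unfolding haar_norm_def using assms by (intro Lq_norm_indicator) auto

lemma haar_norm_mono_AE:
  assumes "0 < q" "S \<in> sets borel" "S \<subseteq> {0<..}" "T \<in> sets borel" "measurable_pos F"
    and "AE u in lebesgue. u \<in> S \<longrightarrow> u \<in> T \<and> F u \<le> G u"
  shows "haar_norm q S F \<le> haar_norm q T G"
  using assms
  by (simp add: haar_norm_UNIV)
     (intro Lq_norm_mono_AE haar_integrand_measurable;
         (auto elim!: eventually_mono intro!: mult_left_mono simp: indicator_def)?)

lemma haar_norm_mono:
  assumes "0 < q" "S \<in> sets borel" "S \<subseteq> {0<..}" "T \<in> sets borel" "measurable_pos F"
    and "S \<subseteq> T" "\<And>u. u \<in> S \<Longrightarrow> F u \<le> G u"
  shows "haar_norm q S F \<le> haar_norm q T G"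
  using assms by (intro haar_norm_mono_AE) auto

lemma haar_norm_cong:
  assumes "\<And>u. u \<in> S \<Longrightarrow> F u = G u" "0 < q" "S \<in> sets borel"
  shows "haar_norm q S F = haar_norm q S G"
proof -
  have "(\<lambda>u. ennreal (u powr (- recip q)) * F u * indicator S u) =
    (\<lambda>u. ennreal (u powr (- recip q)) * G u * indicator S u)"
    using assms(1) by (auto simp: indicator_def fun_eq_iff)
  then show ?thesis using assms by (simp add: haar_norm_UNIV)
qed

lemma haar_norm_cmult_le:
  assumes "0 < q" "S \<in> sets borel" "S \<subseteq> {0<..}" "measurable_pos F"
  shows "haar_norm q S (\<lambda>u. c * F u) \<le> c * haar_norm q S F"
  using assms Lq_norm_cmult_le[OF haar_integrand_measurable[OF assms(4,2,3)] assms(1), of c "- recip q"]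
  by (simp add: haar_norm_UNIV mult_ac)

text \<open>
  The lower estimate is the previous lemma for the factor \<open>inverse c\<close>.
\<close>

lemma haar_norm_cmult:
  assumes "0 < q" "S \<in> sets borel" "S \<subseteq> {0<..}" "measurable_pos F" "c < \<infinity>"
  shows "haar_norm q S (\<lambda>u. c * F u) = c * haar_norm q S F"
proof (rule antisym[OF haar_norm_cmult_le[OF assms(1-4)]])
  show "c * haar_norm q S F \<le> haar_norm q S (\<lambda>u. c * F u)"
  proof (cases "c = 0")
    case False
    then have c: "c * inverse c = 1" using assms(5)
        by (simp add: ennreal_divide_self flip: divide_ennreal_def)
    have "haar_norm q S F = haar_norm q S (\<lambda>u. inverse c * (c * F u))"
      using c by (simp add: mult.assoc[symmetric] mult.commute)
    also have "\<dots> \<le> inverse c * haar_norm q S (\<lambda>u. c * F u)"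
      using assms by (intro haar_norm_cmult_le) auto
    finally have "c * haar_norm q S F \<le> c * (inverse c * haar_norm q S (\<lambda>u. c * F u))"
      by (rule mult_left_mono) simp
    then show ?thesis by (simp only: mult.assoc[symmetric] c mult_1)
  qed simp
qed

lemma haar_norm_add_le:
  assumes q: "0 < q"
  shows "\<exists>C<\<infinity>. \<forall>S F G. S \<in> sets borel \<longrightarrow> S \<subseteq> {0<..} \<longrightarrow> measurable_pos F \<longrightarrow> measurable_pos G \<longrightarrow>
    haar_norm q S (\<lambda>u. F u + G u) \<le> C * (haar_norm q S F + haar_norm q S G)"
proof -
  obtain C where C: "C < \<infinity>" "\<And>f g. f\<in>borel_measurable lebesgue \<Longrightarrow> g\<in>borel_measurable lebesgue \<Longrightarrow>
    Lq_norm q UNIV (\<lambda>x. f x + g x) \<le> C * (Lq_norm q UNIV f + Lq_norm q UNIV g)"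
    using Lq_norm_add_le[OF q] by blast
  show ?thesis
  proof (intro exI[of _ C] conjI C(1) allI impI)
    fix S :: "real set" and F G :: "real \<Rightarrow> ennreal" assume "S \<in> sets borel" "S \<subseteq> {0<..}"
        "measurable_pos F" "measurable_pos G"
    then show "haar_norm q S (\<lambda>u. F u + G u) \<le> C * (haar_norm q S F + haar_norm q S G)"
      using C(2)[OF haar_integrand_measurable haar_integrand_measurable, of F S G S "- recip q"
          "- recip q"] q
      by (simp add: haar_norm_UNIV algebra_simps)
  qed
qed

text \<open>
  The finite exceptional set absorbs the common endpoint of two adjacent open intervals.
\<close>

lemma haar_norm_split_le:
  assumes q: "0 < q"
  shows "\<exists>C<\<infinity>. \<forall>S T U F. S \<in> sets borel \<longrightarrow> T \<in> sets borel \<longrightarrow> U \<in> sets borel \<longrightarrow> 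
     S \<subseteq> {0<..} \<longrightarrow> T \<subseteq> {0<..} \<longrightarrow> U \<subseteq> {0<..} \<longrightarrow> measurable_pos F \<longrightarrow> finite (U - (S \<union> T)) \<longrightarrow>
    haar_norm q U F \<le> C * (haar_norm q S F + haar_norm q T F)"
proof -
  obtain C where C: "C < \<infinity>" "\<And>S F G. S \<in> sets borel \<Longrightarrow> S \<subseteq> {0<..} \<Longrightarrow> measurable_pos F \<Longrightarrow> measurable_pos G \<Longrightarrow>
    haar_norm q S (\<lambda>u. F u + G u) \<le> C * (haar_norm q S F + haar_norm q S G)"
    using haar_norm_add_le[OF q] by blast
  show ?thesis
  proof (intro exI[of _ C] conjI C(1) allI impI)
    fix S T U :: "real set" and F :: "real \<Rightarrow> ennreal"
    assume *: "S \<in> sets borel" "T \<in> sets borel" "U \<in> sets borel" 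
      "S \<subseteq> {0<..}" "T \<subseteq> {0<..}" "U \<subseteq> {0<..}" "measurable_pos F" "finite (U - (S \<union> T))"
    have ind: "haar_norm q {0<..} (\<lambda>u. F u * indicator V u) \<le> haar_norm q V F"
      if "V \<in> sets borel" "V \<subseteq> {0<..}" for V
    proof -
      have "(\<lambda>u. ennreal (u powr (- recip q)) * (F u * indicator V u) * indicator {0<..} u)
        = (\<lambda>u. ennreal (u powr (- recip q)) * F u * indicator V u)"
        using that by (auto simp: indicator_def fun_eq_iff)
      then show ?thesis using that q by (simp add: haar_norm_UNIV)
    qed
    have "AE u in lebesgue. u \<notin> U - (S \<union> T)"
      using *(8) by (intro AE_not_in) (auto intro: finite_imp_null_set_lborel null_sets_completionI)
    then have "AE u in lebesgue. u \<in> U \<longrightarrow> u \<in> {0<..} \<and> F u \<le> F u * indicator S u + F u * indicator T u"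
      by eventually_elim (use *(6) in \<open>auto simp: indicator_def\<close>)
    then have "haar_norm q U F \<le> haar_norm q {0<..} (\<lambda>u. F u * indicator S u + F u * indicator T u)"
      using * q by (intro haar_norm_mono_AE) auto
    also have "\<dots> \<le> C * (haar_norm q {0<..} (\<lambda>u. F u * indicator S u) + haar_norm q {0<..} (\<lambda>u. F u *
        indicator T u))"
      using * by (intro C(2) measurable_pos_mult measurable_pos_indicator) auto
    also have "\<dots> \<le> C * (haar_norm q S F + haar_norm q T F)"
      using * by (intro mult_left_mono add_mono ind) auto
    finally show "haar_norm q U F \<le> C * (haar_norm q S F + haar_norm q T F)" .
  qed
qed

lemma recip_enn2real: "0 < q \<Longrightarrow> recip q = 1 / enn2real q"
  by (cases q) (auto simp: recip_def divide_ennreal simp flip: ennreal_1)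

text \<open>
  The intervals \<open>(t,2t)\<close> have equal mass for \<open>du/u\<close>, hence one constant serves all \<open>t\<close>.  The value \<open>c\<close>
  may be infinite, which is how finiteness of a quasi-norm is turned into finiteness of its integrand.
\<close>

lemma haar_norm_lower:
  assumes q: "0 < q"
  shows "\<exists>C<\<infinity>. \<forall>t>0. \<forall>F c. measurable_pos F \<longrightarrow> (\<forall>u\<in>{t<..<2*t}. c \<le> F u) \<longrightarrow>
    c \<le> C * haar_norm q {t<..<2*t} F"
proof -
  have main: "\<exists>C<\<infinity>. \<forall>t>0. \<forall>c. c \<le> C * haar_norm q {t<..<2*t} (\<lambda>u. c)"
  proof (cases "q = \<infinity>")
    case True
    have "c \<le> 1 * haar_norm q {t<..<2*t} (\<lambda>u. c)" if "t > 0" for t :: real and c :: ennreal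
    proof (rule ccontr)
      let ?f = "\<lambda>u. ennreal (u powr (- recip q)) * c * indicator {t<..<2*t} u"
      assume "\<not> ?thesis"
      then have less: "esssup lebesgue ?f < c"
        using q True by (simp add: haar_norm_UNIV Lq_norm_def not_le)
      have "AE u in lebesgue. ?f u \<le> esssup lebesgue ?f" by (rule esssup_AE)
      then have "AE u in lebesgue. u \<notin> {t<..<2*t}"
        by eventually_elim (use less that True in \<open>auto simp: recip_def indicator_def split: if_splits\<close>)
      then have "emeasure lebesgue {u \<in> space lebesgue. \<not> u \<notin> {t<..<2*t}} = 0"
        by (subst (asm) AE_iff_measurable[OF _ refl]) auto
      moreover have "{u \<in> space lebesgue. \<not> u \<notin> {t<..<2*t}} = {t<..<2*t}" by auto
      ultimately have "emeasure lebesgue {t<..<2*t} = 0" by simp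
      then show False using that by simp
    qed
    then show ?thesis by (intro exI[of _ 1]) auto
  next
    case False
    define p where "p = enn2real q"
    have p: "0 < p" using q False by (simp add: enn2real_pos p_def)
    have r: "recip q = 1 / p" using q by (simp add: recip_enn2real p_def)
    define C where "C = epowr (ennreal 2) (1 / p)"
    have "c \<le> C * haar_norm q {t<..<2*t} (\<lambda>u. c)" if t: "t > 0" for t :: real and c :: ennreal
    proof -
      let ?f = "\<lambda>u. ennreal (u powr (- recip q)) * c * indicator {t<..<2*t} u"
      \<comment> \<open>The integral of \<open>1/u\<close> over \<open>(t,2t)\<close> is at least \<open>1/2\<close>, as \<open>1/u \<ge> 1/(2t)\<close> there.\<close>
      have "ennreal (1 / (2 * t)) * ennreal t = ennreal (1 / 2)"
        using t by (simp flip: ennreal_mult)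
      moreover have "ennreal 2 * ennreal (1 / 2) = 1"
        by (subst ennreal_mult[symmetric]) auto
      ultimately have "ennreal 2 * (ennreal (1 / (2 * t)) * ennreal t) = 1"
        by simp
      then have "epowr c p = ennreal 2 * (epowr c p * ennreal (1 / (2 * t)) * ennreal t)"
        by (metis mult.assoc mult.commute mult_1)
      also have "epowr c p * ennreal (1 / (2 * t)) * ennreal t
        = (\<integral>\<^sup>+u. (epowr c p * ennreal (1 / (2 * t))) * indicator {t<..<2*t} u \<partial>lebesgue)"
        using t by (subst nn_integral_cmult_indicator) auto
      also have "\<dots> \<le> (\<integral>\<^sup>+u. epowr (?f u) p \<partial>lebesgue)"
      proof (intro nn_integral_mono)
        fix u
        show "epowr c p * ennreal (1 / (2 * t)) * indicator {t<..<2*t} u \<le> epowr (?f u) p"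
        proof (cases "u \<in> {t<..<2*t}")
          case True
          have "(u powr (- recip q)) powr p = u powr (-1)"
            using p by (simp add: r powr_powr)
          also have "\<dots> = 1 / u" using True t by (simp add: powr_minus_divide)
          finally have "epowr (ennreal (u powr (- recip q))) p = ennreal (1 / u)"
            by (simp add: epowr_def)
          moreover have "ennreal (1 / (2 * t)) \<le> ennreal (1 / u)"
            using True t by (intro ennreal_leI divide_left_mono) auto
          ultimately show ?thesis
            using True p by (simp add: epowr_mult mult.commute mult_left_mono)
        qed simp
      qed
      finally have "epowr c p \<le> ennreal 2 * (\<integral>\<^sup>+u. epowr (?f u) p \<partial>lebesgue)"
        by (simp add: mult_left_mono)
      then have "epowr (epowr c p) (1/p) \<le> epowr (ennreal 2 * (\<integral>\<^sup>+u. epowr (?f u) p \<partial>lebesgue)) (1/p)"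
        using p by (intro epowr_mono) auto
      then show ?thesis
        using p q False by (simp add: epowr_mult haar_norm_UNIV Lq_norm_def C_def flip: p_def)
    qed
    moreover have "C < \<infinity>" unfolding C_def by (simp only: epowr_less_top) simp
    ultimately show ?thesis by blast
  qed
  then obtain C where C: "C < \<infinity>" "\<And>t c. t > 0 \<Longrightarrow> c \<le> C * haar_norm q {t<..<2*t} (\<lambda>u. c)"
    by blast
  show ?thesis
  proof (intro exI[of _ C] conjI C(1) allI impI)
    fix t :: real and F c assume t: "t > 0" and F: "measurable_pos F" and le: "\<forall>u\<in>{t<..<2*t}. c \<le> F u"
    have "haar_norm q {t<..<2*t} (\<lambda>u. c) \<le> haar_norm q {t<..<2*t} F"
      using q t le by (intro haar_norm_mono) auto
    then show "c \<le> C * haar_norm q {t<..<2*t} F"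
      using C(2)[OF t, of c] by (meson order_trans mult_left_mono zero_le)
  qed
qed

lemma nn_integral_powr_from_0:
  assumes "0 < e" "0 < t"
  shows "(\<integral>\<^sup>+u. ennreal (u powr (e - 1)) * indicator {0<..<t} u \<partial>lebesgue) \<le> ennreal (t powr e / e)"
proof -
  have "(\<integral>\<^sup>+u. ennreal (u powr (e - 1)) * indicator {0<..<t} u \<partial>lebesgue)
     \<le> (\<integral>\<^sup>+u. ennreal (u powr (e - 1)) * indicator {0..t} u \<partial>lebesgue)"
    by (intro nn_integral_mono) (auto simp: indicator_def)
  also have "\<dots> = (\<integral>\<^sup>+u. ennreal (u powr (e - 1)) * indicator {0..t} u \<partial>lborel)"
    by (simp add: nn_integral_completion)
  also have "\<dots> = ennreal (t powr e / e)"
    using has_integral_powr_from_0[of "e - 1" t] assms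
    by (intro nn_integral_has_integral_lebesgue') auto
  finally show ?thesis .
qed

lemma nn_integral_powr_to_inf:
  assumes "0 < e" "0 < t"
  shows "(\<integral>\<^sup>+u. ennreal (u powr (- e - 1)) * indicator {t<..} u \<partial>lebesgue) \<le> ennreal (t powr (- e) / e)"
proof -
  have "(\<integral>\<^sup>+u. ennreal (u powr (- e - 1)) * indicator {t<..} u \<partial>lebesgue)
     \<le> (\<integral>\<^sup>+u. ennreal (u powr (- e - 1)) * indicator {t..} u \<partial>lebesgue)"
    by (intro nn_integral_mono) (auto simp: indicator_def)
  also have "\<dots> = (\<integral>\<^sup>+u. ennreal (u powr (- e - 1)) * indicator {t..} u \<partial>lborel)"
    by (simp add: nn_integral_completion)
  also have "\<dots> = ennreal (t powr (- e) / e)"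
    using has_integral_powr_to_inf[of "- e - 1" t] assms
    by (intro nn_integral_has_integral_lebesgue') auto
  finally show ?thesis .
qed

text \<open>
  Dilation invariance again: for finite \<open>q\<close> both quasi-norms are \<open>(1/(d q)) powr (1/q)\<close> for every \<open>t\<close>.
\<close>

lemma haar_norm_power_le:
  assumes q: "0 < q" and d: "0 < d"
  shows "\<exists>C<\<infinity>. \<forall>t>0. haar_norm q {0<..<t} (\<lambda>u. ennreal ((u / t) powr d)) \<le> C \<and>
    haar_norm q {t<..} (\<lambda>u. ennreal ((t / u) powr d)) \<le> C"
proof (cases "q = \<infinity>")
  case True
  have "haar_norm q {0<..<t} (\<lambda>u. ennreal ((u / t) powr d)) \<le> 1 \<and>
    haar_norm q {t<..} (\<lambda>u. ennreal ((t / u) powr d)) \<le> 1" if "0 < t" for t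
  proof -
    have le: "x powr d \<le> 1" if "0 < x" "x < 1" for x
      using that d powr_le1[of d x] by simp
    have "(\<lambda>u. ennreal (u powr (- recip q)) * ennreal ((u / t) powr d) * indicator {0<..<t} u) \<in>
        borel_measurable lebesgue"
      using that by (intro haar_integrand_measurable measurable_pos_borel) auto
    moreover have "(\<lambda>u. ennreal (u powr (- recip q)) * ennreal ((t / u) powr d) * indicator {t<..}
        u) \<in> borel_measurable lebesgue"
      using that by (intro haar_integrand_measurable measurable_pos_borel) auto
    ultimately show ?thesis using True q that
      by (auto simp: haar_norm_UNIV Lq_norm_def recip_def indicator_def intro!: esssup_I AE_I2 le)
  qed
  then show ?thesis by (intro exI[of _ 1]) auto
next
  case False
  define p where "p = enn2real q"
  have p: "0 < p" using q False by (simp add: enn2real_pos p_def)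
  have r: "recip q = 1 / p" using q by (simp add: recip_enn2real p_def)
  have dp: "0 < d * p" using d p by simp
  define C where "C = epowr (ennreal (1 / (d * p))) (1 / p)"
  have C: "C < \<infinity>" unfolding C_def by (simp only: epowr_less_top) simp
  have "haar_norm q {0<..<t} (\<lambda>u. ennreal ((u / t) powr d)) \<le> C" if t: "0 < t" for t
  proof -
    have "epowr (ennreal (u powr (- recip q)) * ennreal ((u / t) powr d) * indicator {0<..<t} u) p
        = ennreal (t powr (- (d * p))) * (ennreal (u powr (d * p - 1)) * indicator {0<..<t} u)" for u
    proof (cases "u \<in> {0<..<t}")
      case True
      have "(u powr (- (1/p)) * (u / t) powr d) powr p = t powr (- (d * p)) * u powr (d * p - 1)"
        using True p by (simp add: powr_mult powr_divide powr_powr powr_diff powr_minus field_simps)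
      then show ?thesis using True by (simp add: r epowr_def flip: ennreal_mult)
    qed simp
    then have "(\<integral>\<^sup>+u. epowr (ennreal (u powr (- recip q)) * ennreal ((u / t) powr d) * indicator
        {0<..<t} u) p \<partial>lebesgue)
      = ennreal (t powr (- (d * p))) * (\<integral>\<^sup>+u. ennreal (u powr (d * p - 1)) * indicator {0<..<t} u
          \<partial>lebesgue)"
      by (simp only:) (intro nn_integral_cmult measurable_completion, measurable)
    also have "\<dots> \<le> ennreal (t powr (- (d * p))) * ennreal (t powr (d * p) / (d * p))"
      by (intro mult_left_mono nn_integral_powr_from_0 dp t) simp
    also have "\<dots> = ennreal (1 / (d * p))"
      using t dp by (simp add: powr_minus flip: ennreal_mult)
    finally show ?thesis using p q False unfolding C_def
      by (simp add: haar_norm_UNIV Lq_norm_def epowr_mono flip: p_def)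
  qed
  moreover have "haar_norm q {t<..} (\<lambda>u. ennreal ((t / u) powr d)) \<le> C" if t: "0 < t" for t
  proof -
    have "epowr (ennreal (u powr (- recip q)) * ennreal ((t / u) powr d) * indicator {t<..} u) p
        = ennreal (t powr (d * p)) * (ennreal (u powr (- (d * p) - 1)) * indicator {t<..} u)" for u
    proof (cases "u \<in> {t<..}")
      case True
      then have "u > 0" using t by auto
      then have "(u powr (- (1/p)) * (t / u) powr d) powr p = t powr (d * p) * u powr (- (d * p) - 1)"
        using t p by (simp add: powr_mult powr_divide powr_powr powr_diff powr_minus field_simps)
      then show ?thesis using True by (simp add: r epowr_def flip: ennreal_mult)
    qed simp
    then have "(\<integral>\<^sup>+u. epowr (ennreal (u powr (- recip q)) * ennreal ((t / u) powr d) * indicator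
        {t<..} u) p \<partial>lebesgue)
      = ennreal (t powr (d * p)) * (\<integral>\<^sup>+u. ennreal (u powr (- (d * p) - 1)) * indicator {t<..} u
          \<partial>lebesgue)"
      by (simp only:) (intro nn_integral_cmult measurable_completion, measurable)
    also have "\<dots> \<le> ennreal (t powr (d * p)) * ennreal (t powr (- (d * p)) / (d * p))"
      by (intro mult_left_mono nn_integral_powr_to_inf dp t) simp
    also have "\<dots> = ennreal (1 / (d * p))"
      using t dp by (simp add: powr_minus flip: ennreal_mult)
    finally show ?thesis using p q False t unfolding C_def
      by (simp add: haar_norm_UNIV Lq_norm_def epowr_mono flip: p_def)
  qed
  ultimately show ?thesis using C by blast
qed

text \<open>
  A function that decays like a power towards \<open>0\<close> (or, in the next lemma, towards \<open>\<infinity>\<close>) has a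
  quasi-norm at most a multiple of its size \<open>c\<close> at the end point \<open>t\<close>.  All upper bounds
      for quasi-norms of
  weights come from this pair of lemmas after a pointwise use of Potter bounds.
\<close>

lemma haar_norm_growth_below:
  assumes q: "0 < q" and d: "0 < d"
  shows "\<exists>C<\<infinity>. \<forall>t>0. \<forall>S F c. S \<in> sets borel \<longrightarrow> measurable_pos F \<longrightarrow> S \<subseteq> {0<..<t} \<longrightarrow>
    (\<forall>u\<in>S. F u \<le> c * ennreal ((u / t) powr d)) \<longrightarrow> haar_norm q S F \<le> C * c"
proof -
  obtain C where C: "C < \<infinity>" "\<And>t. t > 0 \<Longrightarrow> haar_norm q {0<..<t} (\<lambda>u. ennreal ((u / t) powr d)) \<le> C"
    using haar_norm_power_le[OF q d] by blast
  show ?thesis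
  proof (intro exI[of _ C] conjI C(1) allI impI)
    fix t :: real and S F c
    assume *: "t > 0" "S \<in> sets borel" "measurable_pos F" "S \<subseteq> {0<..<t}"
      "\<forall>u\<in>S. F u \<le> c * ennreal ((u / t) powr d)"
    have "haar_norm q S F \<le> haar_norm q {0<..<t} (\<lambda>u. c * ennreal ((u / t) powr d))"
      using * q by (intro haar_norm_mono) auto
    also have "\<dots> \<le> c * haar_norm q {0<..<t} (\<lambda>u. ennreal ((u / t) powr d))"
      using * q by (intro haar_norm_cmult_le measurable_pos_borel) auto
    also have "\<dots> \<le> c * C" using * by (intro mult_left_mono C) auto
    finally show "haar_norm q S F \<le> C * c" by (simp add: mult.commute)
  qed
qed

lemma haar_norm_growth_above:
  assumes q: "0 < q" and d: "0 < d"
  shows "\<exists>C<\<infinity>. \<forall>t>0. \<forall>S F c. S \<in> sets borel \<longrightarrow> measurable_pos F \<longrightarrow> S \<subseteq> {t<..} \<longrightarrow>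
    (\<forall>u\<in>S. F u \<le> c * ennreal ((t / u) powr d)) \<longrightarrow> haar_norm q S F \<le> C * c"
proof -
  obtain C where C: "C < \<infinity>" "\<And>t. t > 0 \<Longrightarrow> haar_norm q {t<..} (\<lambda>u. ennreal ((t / u) powr d)) \<le> C"
    using haar_norm_power_le[OF q d] by blast
  show ?thesis
  proof (intro exI[of _ C] conjI C(1) allI impI)
    fix t :: real and S F c
    assume *: "t > 0" "S \<in> sets borel" "measurable_pos F" "S \<subseteq> {t<..}"
      "\<forall>u\<in>S. F u \<le> c * ennreal ((t / u) powr d)"
    have "haar_norm q S F \<le> haar_norm q {t<..} (\<lambda>u. c * ennreal ((t / u) powr d))"
      using * q by (intro haar_norm_mono) auto
    also have "\<dots> \<le> c * haar_norm q {t<..} (\<lambda>u. ennreal ((t / u) powr d))"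
      using * q by (intro haar_norm_cmult_le measurable_pos_borel) auto
    also have "\<dots> \<le> c * C" using * by (intro mult_left_mono C) auto
    finally show "haar_norm q S F \<le> C * c" by (simp add: mult.commute)
  qed
qed

section \<open>Slowly varying weights\<close>

lemma SV_pos: "b \<in> SV \<Longrightarrow> 0 < t \<Longrightarrow> 0 < b t"
  by (simp add: SV_def)

lemma SV_measurable_pos: "b \<in> SV \<Longrightarrow> measurable_pos (\<lambda>u. ennreal (b u))"
  unfolding SV_def measurable_pos_def by (intro measurable_compose[OF _ measurable_ennreal]) auto

text \<open>
  The two bounds say that \<open>t powr (- e) * b t\<close> is almost decreasing and \<open>t powr e * b t\<close> almost
  increasing; passing through the monotone equivalents squares the constants.
\<close>

lemma SV_Potter:
  assumes b: "b \<in> SV" and e: "0 < e"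
  shows "\<exists>C>0. \<forall>u>0. \<forall>t\<ge>u. b t \<le> C * (t / u) powr e * b u \<and> b u \<le> C * (t / u) powr e * b t"
proof -
  obtain g h C D where g: "mono_on {0<..} g" and C: "C > 0"
      "\<And>t. t > 0 \<Longrightarrow> (1 / C) * g t \<le> t powr e * b t \<and> t powr e * b t \<le> C * g t"
    and h: "antimono_on {0<..} h" and D: "D > 0"
      "\<And>t. t > 0 \<Longrightarrow> (1 / D) * h t \<le> t powr (-e) * b t \<and> t powr (-e) * b t \<le> D * h t"
    using b e unfolding SV_def equivalent_on_def by fastforce
  have "b t \<le> (C\<^sup>2 + D\<^sup>2) * (t / u) powr e * b u \<and> b u \<le> (C\<^sup>2 + D\<^sup>2) * (t / u) powr e * b t"
    if u: "u > 0" and ut: "u \<le> t" for u t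
  proof -
    have t: "t > 0" using u ut by simp
    have pos: "b u > 0" "b t > 0" using b u t by (auto simp: SV_pos)
    have q: "(t / u) powr e = t powr e / u powr e" using u t by (simp add: powr_divide)
    have "u powr e * b u \<le> C * g u" using C u by auto
    also have "\<dots> \<le> C * g t" using g u ut C by (auto simp: monotone_on_def)
    also have "\<dots> \<le> C * (C * (t powr e * b t))" using C t by (auto simp: field_simps)
    finally have 1: "b u \<le> C\<^sup>2 * (t / u) powr e * b t"
      using u t by (simp add: q field_simps power2_eq_square)
    have "t powr (-e) * b t \<le> D * h t" using D t by auto
    also have "\<dots> \<le> D * h u" using h u ut D by (auto simp: monotone_on_def)
    also have "\<dots> \<le> D * (D * (u powr (-e) * b u))" using D u by (auto simp: field_simps)
    finally have 2: "b t \<le> D\<^sup>2 * (t / u) powr e * b u"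
      using u t by (simp add: q field_simps power2_eq_square powr_minus)
    have "C\<^sup>2 * ((t / u) powr e * b t) \<le> (C\<^sup>2 + D\<^sup>2) * ((t / u) powr e * b t)"
      "D\<^sup>2 * ((t / u) powr e * b u) \<le> (C\<^sup>2 + D\<^sup>2) * ((t / u) powr e * b u)"
      using pos by (auto intro!: mult_right_mono)
    then show ?thesis using 1 2 by (auto simp: mult.assoc)
  qed
  moreover have "C\<^sup>2 + D\<^sup>2 > 0" using C(1) by (simp add: add_pos_nonneg)
  ultimately show ?thesis by blast
qed

text \<open>
  On \<open>(t/2,t)\<close> a Potter bound keeps \<open>b\<close> above a fixed multiple of \<open>b t\<close>, and this interval has a fixed
  mass for \<open>du/u\<close>.
\<close>

lemma SV_haar_lower:
  assumes b: "b \<in> SV" and q: "0 < q"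
  shows "\<exists>C<\<infinity>. \<forall>t>0. ennreal (b t) \<le> C * haar_norm q {t/2<..<t} (\<lambda>u. ennreal (b u))"
proof -
  obtain C where C: "C < \<infinity>" "\<And>t F c. t > 0 \<Longrightarrow> measurable_pos F \<Longrightarrow> \<forall>u\<in>{t<..<2*t}. c \<le> F u \<Longrightarrow>
    c \<le> C * haar_norm q {t<..<2*t} F"
    using haar_norm_lower[OF q] by meson
  obtain D where D: "D > 0" "\<And>u t. u > 0 \<Longrightarrow> t \<ge> u \<Longrightarrow> b t \<le> D * (t / u) powr 1 * b u"
    using SV_Potter[OF b, of 1] by (auto simp del: powr_one)
  have "ennreal (b t) \<le> ennreal (2 * D) * C * haar_norm q {t/2<..<t} (\<lambda>u. ennreal (b u))" if t:
      "t > 0" for t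
  proof -
    have "\<forall>u\<in>{t/2<..<2*(t/2)}. ennreal (b t / (2 * D)) \<le> ennreal (b u)"
    proof
      fix u assume u: "u \<in> {t/2<..<2*(t/2)}"
      have u0: "u > 0" "u \<le> t" "t / u \<le> 2" using u t by (auto simp: field_simps)
      have "b t \<le> D * (t / u) powr 1 * b u" using u0 by (intro D) auto
      also have "\<dots> \<le> D * 2 * b u"
        using u0 D(1) SV_pos[OF b u0(1)] t by (intro mult_right_mono mult_left_mono) auto
      finally show "ennreal (b t / (2 * D)) \<le> ennreal (b u)"
        using D(1) by (intro ennreal_leI) (simp add: field_simps)
    qed
    then have "ennreal (b t / (2 * D)) \<le> C * haar_norm q {t/2<..<2*(t/2)} (\<lambda>u. ennreal (b u))"
      using t b by (intro C(2) SV_measurable_pos) auto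
    then have "ennreal (2 * D) * ennreal (b t / (2 * D))
        \<le> ennreal (2 * D) * (C * haar_norm q {t/2<..<t} (\<lambda>u. ennreal (b u)))"
      by (intro mult_left_mono) auto
    moreover have "ennreal (2 * D) * ennreal (b t / (2 * D)) = ennreal (b t)"
      using D(1) SV_pos[OF b t] by (simp flip: ennreal_mult)
    ultimately show ?thesis by (simp add: mult.assoc)
  qed
  moreover have "ennreal (2 * D) * C < \<infinity>" using C(1) by (simp add: ennreal_mult_less_top)
  ultimately show ?thesis by blast
qed

section \<open>Quasi-concave functions and the weight chi\<close>

text \<open>
  The properties that a \<open>K\<close>-functional \<open>t \<mapsto> K(t, f)\<close> has for every
  \<open>f\<close> in \<open>A0 + A1\<close>; the second one says that \<open>k t / t\<close>
  decreases.
\<close>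

definition quasi_concave :: "(real \<Rightarrow> ennreal) \<Rightarrow> bool" where
  "quasi_concave k \<longleftrightarrow> mono k \<and> (\<forall>u>0. \<forall>t\<ge>u. k t \<le> ennreal (t / u) * k u) \<and> (\<forall>u>0. k u < \<infinity>)"

lemma quasi_concave_measurable [intro]: "quasi_concave k \<Longrightarrow> measurable_pos k"
  by (simp add: quasi_concave_def measurable_pos_mono)

lemma quasi_concave_ratio:
  assumes "quasi_concave k" "0 < u" "u \<le> t"
  shows "k t * ennreal (1 / t) \<le> k u * ennreal (1 / u)"
proof -
  have "k t * ennreal (1 / t) \<le> (ennreal (t / u) * k u) * ennreal (1 / t)"
    using assms by (intro mult_right_mono) (auto simp: quasi_concave_def)
  also have "\<dots> = k u * (ennreal (t / u) * ennreal (1 / t))" by (simp add: mult_ac)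
  also have "ennreal (t / u) * ennreal (1 / t) = ennreal (1 / u)"
    using assms by (simp flip: ennreal_mult)
  finally show ?thesis .
qed

text \<open>
  The last two assumptions are the integrability conditions on \<open>a1\<close> and \<open>b1\<close>, restated for \<open>du/u\<close>;
  they make the weight \<open>Chi\<close> finite.
\<close>

locale limiting_parameters =
  fixes q1 r1 r0 :: ennreal and a1 b1 b0 :: "real \<Rightarrow> real" and \<theta> :: real
  assumes q1: "0 < q1" and r1: "0 < r1" and r0: "0 < r0"
    and a1: "a1 \<in> SV" and b1: "b1 \<in> SV" and b0: "b0 \<in> SV"
    and \<theta>: "0 < \<theta>" "\<theta> < 1"
    and tail_finite: "haar_norm r1 {1<..} (\<lambda>s. ennreal (b1 s)) < \<infinity>"
    and head_finite: "haar_norm r1 {0<..<1} (\<lambda>s. ennreal (b1 s) * haar_norm q1 {0<..<s} (\<lambda>u. ennreal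
        (a1 u))) < \<infinity>"
begin

definition Phi :: "real \<Rightarrow> ennreal" where
  "Phi s = haar_norm q1 {0<..<s} (\<lambda>u. ennreal (a1 u))"

definition tail :: "real \<Rightarrow> ennreal" where
  "tail t = haar_norm r1 {t<..} (\<lambda>s. ennreal (b1 s))"

definition Chi :: "real \<Rightarrow> ennreal" where
  "Chi t = haar_norm r1 {0<..<t} (\<lambda>s. ennreal (b1 s) * Phi s) + tail t * Phi t"

lemmas weight_measurable [intro, simp] =
  SV_measurable_pos[OF a1] SV_measurable_pos[OF b1] SV_measurable_pos[OF b0]

lemma mono_Phi: "mono Phi"
  unfolding Phi_def using q1 by (intro monoI haar_norm_mono) auto

lemma Phi_measurable [intro, simp]: "measurable_pos Phi"
  by (rule measurable_pos_mono[OF mono_Phi])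

lemma Phi_min_measurable [intro, simp]: "measurable_pos (\<lambda>s. Phi (min s t))"
  using mono_Phi by (intro measurable_pos_mono) (auto simp: mono_def intro!: min.mono)

lemma a1_le_Phi: "\<exists>C<\<infinity>. \<forall>t>0. ennreal (a1 t) \<le> C * Phi t"
proof -
  obtain C where C: "C < \<infinity>" "\<And>t. t > 0 \<Longrightarrow> ennreal (a1 t)
      \<le> C * haar_norm q1 {t/2<..<t} (\<lambda>u. ennreal (a1 u))"
    using SV_haar_lower[OF a1 q1] by blast
  have "C * haar_norm q1 {t/2<..<t} (\<lambda>u. ennreal (a1 u)) \<le> C * Phi t" if "t > 0" for t
    unfolding Phi_def using that q1 by (intro mult_left_mono haar_norm_mono) auto
  then show ?thesis using C by (meson order_trans)
qed

text \<open>
  On \<open>(u,t)\<close> the Potter bound compares \<open>a1\<close> with its value at \<open>u\<close>, and that value is dominated by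
  \<open>Phi u\<close>; so \<open>Phi\<close> inherits the growth of a slowly varying function.
\<close>

lemma Phi_growth:
  assumes e: "0 < e"
  shows "\<exists>C<\<infinity>. \<forall>u>0. \<forall>t\<ge>u. Phi t \<le> C * ennreal ((t / u) powr e) * Phi u"
proof -
  obtain C where C: "C < \<infinity>" "\<And>t. t > 0 \<Longrightarrow> ennreal (a1 t) \<le> C * Phi t"
    using a1_le_Phi by blast
  obtain D where D: "D > 0" "\<And>u t. u > 0 \<Longrightarrow> t \<ge> u \<Longrightarrow> a1 t \<le> D * (t / u) powr e * a1 u"
    using SV_Potter[OF a1 e] by blast
  obtain E where E: "E < \<infinity>" "\<And>t S F c. t > 0 \<Longrightarrow> S \<in> sets borel \<Longrightarrow> measurable_pos F \<Longrightarrow>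
     S \<subseteq> {0<..<t} \<Longrightarrow> (\<forall>u\<in>S. F u \<le> c * ennreal ((u / t) powr e)) \<Longrightarrow> haar_norm q1 S F \<le> E * c"
    using haar_norm_growth_below[OF q1 e] by meson
  obtain G where G: "G < \<infinity>" "\<And>S T U F. S \<in> sets borel \<Longrightarrow> T \<in> sets borel \<Longrightarrow> U \<in> sets borel \<Longrightarrow> 
     S \<subseteq> {0<..} \<Longrightarrow> T \<subseteq> {0<..} \<Longrightarrow> U \<subseteq> {0<..} \<Longrightarrow> measurable_pos F \<Longrightarrow> finite (U - (S \<union> T)) \<Longrightarrow>
    haar_norm q1 U F \<le> G * (haar_norm q1 S F + haar_norm q1 T F)"
    using haar_norm_split_le[OF q1] by meson
  have "Phi t \<le> G * (1 + E * ennreal D * C) * ennreal ((t / u) powr e) * Phi u" if u: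
      "0 < u" and ut: "u \<le> t" for u t
  proof -
    define m where "m = ennreal ((t / u) powr e)"
    have m1: "1 \<le> m" unfolding m_def using u ut e by (simp add: ge_one_powr_ge_zero)
    have "haar_norm q1 {u<..<t} (\<lambda>u. ennreal (a1 u)) \<le> E * (ennreal D * m * ennreal (a1 u))"
    proof (rule E(2)[of t])
      show "\<forall>v\<in>{u<..<t}. ennreal (a1 v) \<le> ennreal D * m * ennreal (a1 u) * ennreal ((v / t) powr e)"
      proof
        fix v assume v: "v \<in> {u<..<t}"
        have "a1 v \<le> D * (v / u) powr e * a1 u" using v u by (intro D) auto
        also have "(v / u) powr e = (t / u) powr e * (v / t) powr e"
          using v u by (simp add: powr_divide)
        finally show "ennreal (a1 v) \<le> ennreal D * m * ennreal (a1 u) * ennreal ((v / t) powr e)"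
          using D(1) SV_pos[OF a1 u] unfolding m_def by (simp add: mult_ac flip: ennreal_mult)
      qed
    qed (use u ut in auto)
    also have "\<dots> \<le> E * (ennreal D * m * (C * Phi u))"
      by (intro mult_left_mono C u) auto
    finally have 1: "haar_norm q1 {u<..<t} (\<lambda>u. ennreal (a1 u)) \<le> E * ennreal D * C * m * Phi u"
      by (simp add: mult_ac)
    have 2: "Phi u \<le> m * Phi u" using mult_right_mono[OF m1, of "Phi u"] by simp
    have "{0<..<t} - ({0<..<u} \<union> {u<..<t}) \<subseteq> {u}" by auto
    then have "Phi t \<le> G * (Phi u + haar_norm q1 {u<..<t} (\<lambda>u. ennreal (a1 u)))"
      unfolding Phi_def using u ut by (intro G) (auto intro: finite_subset)
    also have "\<dots> \<le> G * (m * Phi u + E * ennreal D * C * m * Phi u)"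
      by (intro mult_left_mono add_mono 1 2) auto
    finally show ?thesis by (simp add: algebra_simps m_def)
  qed
  moreover have "G * (1 + E * ennreal D * C) < \<infinity>"
    using C(1) E(1) G(1) by (simp add: ennreal_mult_less_top)
  ultimately show ?thesis by blast
qed

text \<open>
  By \<open>Phi_growth\<close>, an infinite value anywhere would make \<open>Phi\<close> infinite everywhere, contrary to
  the integrability near \<open>0\<close>.
\<close>

lemma Phi_finite:
  assumes t: "0 < t" shows "Phi t < \<infinity>"
proof (rule ccontr)
  assume "\<not> Phi t < \<infinity>"
  then have inf: "Phi t = \<infinity>" by (simp add: less_top[symmetric])
  obtain C where C: "C < \<infinity>" "\<And>u t. u > 0 \<Longrightarrow> t \<ge> u \<Longrightarrow> Phi t \<le> C * ennreal ((t / u) powr 1) * Phi u"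
    using Phi_growth[of 1] by auto
  have "Phi s = \<infinity>" if s: "s > 0" for s
  proof (cases "s \<le> t")
    case True
    then show ?thesis using C(2)[OF s True] C(1) inf
      by (auto simp: top_unique ennreal_mult_eq_top_iff)
  next
    case False
    then show ?thesis using monoD[OF mono_Phi, of t s] inf by (simp add: top_unique)
  qed
  moreover have "ennreal (b1 s) \<noteq> 0" if "s > 0" for s
    using SV_pos[OF b1 that] by (simp add: ennreal_eq_0_iff)
  ultimately have *: "\<And>s. s > 0 \<Longrightarrow> ennreal (b1 s) * Phi s = \<infinity>"
    by (simp add: ennreal_mult_eq_top_iff)
  obtain D where D: "D < \<infinity>" "\<And>t F c. t > 0 \<Longrightarrow> measurable_pos F \<Longrightarrow> \<forall>u\<in>{t<..<2*t}. c \<le> F u \<Longrightarrow>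
    c \<le> D * haar_norm r1 {t<..<2*t} F"
    using haar_norm_lower[OF r1] by meson
  \<comment> \<open>The interval \<open>(1/2,1)\<close>, in the form required by the lower bound.\<close>
  have "\<infinity> \<le> D * haar_norm r1 {1/2<..<2*(1/2)} (\<lambda>s. ennreal (b1 s) * Phi s)"
    using * by (intro D(2)) auto
  also have "\<dots> \<le> D * haar_norm r1 {0<..<1} (\<lambda>s. ennreal (b1 s) * Phi s)"
    using r1 by (intro mult_left_mono haar_norm_mono) auto
  also have "\<dots> < \<infinity>" using D(1) head_finite by (simp add: ennreal_mult_less_top Phi_def[abs_def])
  finally show False by simp
qed

lemma Phi_pos:
  assumes t: "0 < t" shows "0 < Phi t"
proof (rule gr_zeroI)
  assume "Phi t = 0"
  moreover obtain C where "\<forall>t>0. ennreal (a1 t) \<le> C * Phi t" using a1_le_Phi by (elim exE conjE)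
  then have "ennreal (a1 t) \<le> C * Phi t" using t by simp
  ultimately show False using SV_pos[OF a1 t] by (simp add: ennreal_eq_0_iff)
qed

lemma tail_pos:
  assumes t: "0 < t" shows "0 < tail t"
proof -
  obtain C where C: "C < \<infinity>" "\<And>t. t > 0 \<Longrightarrow> ennreal (b1 t)
      \<le> C * haar_norm r1 {t/2<..<t} (\<lambda>u. ennreal (b1 u))"
    using SV_haar_lower[OF b1 r1] by blast
  have "haar_norm r1 {2*t/2<..<2*t} (\<lambda>u. ennreal (b1 u)) \<le> tail t"
    unfolding tail_def using t r1 by (intro haar_norm_mono) auto
  then have "C * haar_norm r1 {2*t/2<..<2*t} (\<lambda>u. ennreal (b1 u)) \<le> C * tail t"
    by (rule mult_left_mono) simp
  moreover have "ennreal (b1 (2*t)) \<le> C * haar_norm r1 {2*t/2<..<2*t} (\<lambda>u. ennreal (b1 u))"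
    using t by (intro C) simp
  ultimately have "ennreal (b1 (2*t)) \<le> C * tail t" by (rule order_trans[rotated])
  then show ?thesis
    using SV_pos[OF b1, of "2*t"] t by (intro gr_zeroI) (auto simp: ennreal_eq_0_iff)
qed

lemma Chi_pos: "0 < t \<Longrightarrow> 0 < Chi t"
  using Phi_pos[of t] tail_pos[of t] by (simp add: Chi_def ennreal_zero_less_mult_iff
      zero_less_iff_neq_zero)

text \<open>
  Up to constants, \<open>Chi t\<close> is the single quasi-norm of \<open>b1 s * Phi (min s t)\<close> over the half-line,
  and this integrand satisfies the Potter bounds in \<open>t\<close> for each fixed \<open>s\<close>.
\<close>

lemma Chi_growth_ennreal:
  assumes e: "0 < e"
  shows "\<exists>C<\<infinity>. \<forall>u>0. \<forall>t\<ge>u. Chi t \<le> C * ennreal ((t / u) powr e) * Chi u \<and> Chi u \<le> C * Chi t"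
proof -
  obtain C where C: "C < \<infinity>" "\<And>u t. u > 0 \<Longrightarrow> t \<ge> u \<Longrightarrow> Phi t \<le> C * ennreal ((t / u) powr e) * Phi u"
    using Phi_growth[OF e] by auto
  obtain G where G: "G < \<infinity>" "\<And>S T U F. S \<in> sets borel \<Longrightarrow> T \<in> sets borel \<Longrightarrow> U \<in> sets borel \<Longrightarrow> 
     S \<subseteq> {0<..} \<Longrightarrow> T \<subseteq> {0<..} \<Longrightarrow> U \<subseteq> {0<..} \<Longrightarrow> measurable_pos F \<Longrightarrow> finite (U - (S \<union> T)) \<Longrightarrow>
    haar_norm r1 U F \<le> G * (haar_norm r1 S F + haar_norm r1 T F)"
    using haar_norm_split_le[OF r1] by meson
  define X where "X t = haar_norm r1 {0<..} (\<lambda>s. ennreal (b1 s) * Phi (min s t))" for t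
  have tail: "haar_norm r1 {t<..} (\<lambda>s. ennreal (b1 s) * Phi (min s t)) = tail t * Phi t" if t:
      "t > 0" for t
  proof -
    have "haar_norm r1 {t<..} (\<lambda>s. ennreal (b1 s) * Phi (min s t))
        = haar_norm r1 {t<..} (\<lambda>s. Phi t * ennreal (b1 s))"
      using r1 by (intro haar_norm_cong) (auto simp: mult.commute)
    also have "\<dots> = Phi t * tail t"
      unfolding tail_def using r1 t Phi_finite[OF t] by (intro haar_norm_cmult) auto
    finally show ?thesis by (simp add: mult.commute)
  qed
  have head: "haar_norm r1 {0<..<t} (\<lambda>s. ennreal (b1 s) * Phi (min s t))
      = haar_norm r1 {0<..<t} (\<lambda>s. ennreal (b1 s) * Phi s)" for t
    using r1 by (intro haar_norm_cong) auto
  have Chi_le: "Chi t \<le> 2 * X t" if t: "t > 0" for t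
  proof -
    have "Chi t \<le> X t + X t"
      unfolding Chi_def tail[OF t, symmetric] head[symmetric] unfolding X_def using t r1
      by (intro add_mono haar_norm_mono) auto
    then show ?thesis by (simp add: mult_2)
  qed
  have le_Chi: "X t \<le> G * Chi t" if t: "t > 0" for t
  proof -
    have "{0<..} - ({0<..<t} \<union> {t<..}) \<subseteq> {t}" by auto
    then show ?thesis
      unfolding Chi_def tail[OF t, symmetric] head[symmetric] unfolding X_def using t
      by (intro G) (auto intro: finite_subset)
  qed
  have X_growth: "X t \<le> C * ennreal ((t / u) powr e) * X u \<and> X u \<le> X t" if u: "0 < u" and ut: "u
      \<le> t" for u t
  proof
    have *: "Phi (min s t) \<le> C * ennreal ((t / u) powr e) * Phi (min s u)" if s: "s > 0" for s
    proof -
      define v where "v = min s u"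
      have v: "0 < v" "v \<le> min s t" "min s t / v \<le> t / u"
        using s u ut by (auto simp: v_def min_def field_simps)
      have "Phi (min s t) \<le> C * ennreal ((min s t / v) powr e) * Phi v"
        by (rule C) (use v in auto)
      also have "\<dots> \<le> C * ennreal ((t / u) powr e) * Phi v"
        using v e by (intro mult_right_mono mult_left_mono ennreal_leI powr_mono2) auto
      finally show ?thesis by (simp add: v_def)
    qed
    have "X t \<le> haar_norm r1 {0<..} (\<lambda>s. (C * ennreal ((t / u) powr e)) * (ennreal (b1 s) * Phi (min
        s u)))"
      unfolding X_def using r1 *
      by (intro haar_norm_mono) (auto simp: mult.left_commute intro!: mult_left_mono)
    also have "\<dots> \<le> C * ennreal ((t / u) powr e) * X u"
      unfolding X_def using r1 by (intro haar_norm_cmult_le) auto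
    finally show "X t \<le> C * ennreal ((t / u) powr e) * X u" .
    show "X u \<le> X t"
      unfolding X_def using r1 ut mono_Phi
      by (intro haar_norm_mono) (auto intro!: mult_left_mono elim!: monoD)
  qed
  have "Chi t \<le> (2 * G + 2 * C * G) * ennreal ((t / u) powr e) * Chi u \<and> Chi u
      \<le> (2 * G + 2 * C * G) * Chi t"
    if u: "0 < u" and ut: "u \<le> t" for u t
  proof
    have t: "t > 0" using u ut by simp
    have "Chi t \<le> 2 * X t" by (rule Chi_le[OF t])
    also have "\<dots> \<le> 2 * (C * ennreal ((t / u) powr e) * X u)"
      using X_growth[OF u ut] by (intro mult_left_mono) auto
    also have "\<dots> \<le> 2 * (C * ennreal ((t / u) powr e) * (G * Chi u))"
      by (intro mult_left_mono le_Chi u) auto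
    also have "\<dots> = 2 * C * G * (ennreal ((t / u) powr e) * Chi u)" by (simp add: mult_ac)
    also have "\<dots> \<le> (2 * G + 2 * C * G) * (ennreal ((t / u) powr e) * Chi u)"
      by (intro mult_right_mono) auto
    finally show "Chi t \<le> (2 * G + 2 * C * G) * ennreal ((t / u) powr e) * Chi u"
        by (simp add: mult.assoc)
    have "Chi u \<le> 2 * X u" by (rule Chi_le[OF u])
    also have "\<dots> \<le> 2 * X t" using X_growth[OF u ut] by (intro mult_left_mono) auto
    also have "\<dots> \<le> 2 * (G * Chi t)" by (intro mult_left_mono le_Chi t) auto
    also have "\<dots> \<le> (2 * G + 2 * C * G) * Chi t"
      by (simp only: mult.assoc[symmetric]) (intro mult_right_mono, auto)
    finally show "Chi u \<le> (2 * G + 2 * C * G) * Chi t" .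
  qed
  moreover have "2 * G + 2 * C * G < \<infinity>" using G C by (simp add: ennreal_mult_less_top)
  ultimately show ?thesis by blast
qed

lemma Chi_finite:
  assumes t: "0 < t" shows "Chi t < \<infinity>"
proof -
  obtain C where C: "C < \<infinity>" "\<And>u t. u > 0 \<Longrightarrow> t \<ge> u \<Longrightarrow> Chi t \<le> C * ennreal ((t / u) powr 1) * Chi u"
    "\<And>u t. u > 0 \<Longrightarrow> t \<ge> u \<Longrightarrow> Chi u \<le> C * Chi t"
    using Chi_growth_ennreal[of 1] by auto
  have "Chi 1 < \<infinity>"
    using head_finite tail_finite Phi_finite[of 1]
    by (simp add: Chi_def tail_def Phi_def[abs_def] ennreal_mult_less_top)
  then have "C * ennreal ((t / 1) powr 1) * Chi 1 < \<infinity>" "C * Chi 1 < \<infinity>"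
    using C(1) by (auto simp: ennreal_mult_less_top)
  then show ?thesis using C(2)[of 1 t] C(3)[of t 1] t by (cases "t \<ge> 1") (auto intro: le_less_trans)
qed

definition chi_val :: "real \<Rightarrow> real" where "chi_val t = enn2real (Chi t)"

lemma ennreal_chi_val: "0 < t \<Longrightarrow> ennreal (chi_val t) = Chi t"
  using Chi_finite by (simp add: chi_val_def)

lemma chi_val_pos: "0 < t \<Longrightarrow> 0 < chi_val t"
  using Chi_finite Chi_pos by (simp add: chi_val_def enn2real_positive_iff)

lemma chi_val_growth:
  assumes e: "0 < e"
  shows "\<exists>C>0. \<forall>u>0. \<forall>t\<ge>u. chi_val t \<le> C * (t / u) powr e * chi_val u"
proof -
  obtain C where C: "C < \<infinity>" "\<And>u t. u > 0 \<Longrightarrow> t \<ge> u \<Longrightarrow> Chi t \<le> C * ennreal ((t / u) powr e) * Chi u"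
    using Chi_growth_ennreal[OF e] by blast
  have "chi_val t \<le> (enn2real C + 1) * (t / u) powr e * chi_val u" if u: "0 < u" and ut: "u \<le> t" for u t
  proof -
    have "ennreal (chi_val t) \<le> C * ennreal ((t / u) powr e) * ennreal (chi_val u)"
      using C(2)[OF u ut] u ut by (simp add: ennreal_chi_val)
    also have "C = ennreal (enn2real C)" using C(1) by simp
    finally have "chi_val t \<le> enn2real C * (t / u) powr e * chi_val u"
      using chi_val_pos[OF u] by (simp flip: ennreal_mult)
    also have "\<dots> \<le> (enn2real C + 1) * (t / u) powr e * chi_val u"
      using chi_val_pos[OF u] by (intro mult_right_mono) auto
    finally show ?thesis .
  qed
  then show ?thesis by (intro exI[of _ "enn2real C + 1"]) (auto simp: add_nonneg_pos)
qed

end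

context limiting_parameters begin

section \<open>Estimates for quasi-concave functions\<close>

definition rho_val :: "real \<Rightarrow> real" where
  "rho_val t = t powr (1 - \<theta>) * b0 t / chi_val t"

definition X_weight :: "real \<Rightarrow> ennreal" where
  "X_weight u = ennreal (u powr (- \<theta>) * b0 u)"

definition inner_weight :: "real \<Rightarrow> ennreal" where
  "inner_weight u = ennreal (u powr (- 1) * a1 u)"

text \<open>
  \<open>X_on {0<..}\<close> and \<open>Y_from 0\<close> are the quasi-norms of the two spaces, as functions of \<open>k = K(\<cdot>, f)\<close>;
  \<open>X_on {0<..<t}\<close> and \<open>Y_from t\<close> are the two terms of the formula for the \<open>K\<close>-functional.
\<close>

definition X_on :: "real set \<Rightarrow> (real \<Rightarrow> ennreal) \<Rightarrow> ennreal" where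
  "X_on S k = haar_norm r0 S (\<lambda>u. X_weight u * k u)"

definition inner_from :: "real \<Rightarrow> (real \<Rightarrow> ennreal) \<Rightarrow> real \<Rightarrow> ennreal" where
  "inner_from t k s = haar_norm q1 {t<..<s} (\<lambda>u. inner_weight u * k u)"

definition Y_from :: "real \<Rightarrow> (real \<Rightarrow> ennreal) \<Rightarrow> ennreal" where
  "Y_from t k = haar_norm r1 {t<..} (\<lambda>s. ennreal (b1 s) * inner_from t k s)"

lemma rho_val_pos: "0 < t \<Longrightarrow> 0 < rho_val t"
  using SV_pos[OF b0] chi_val_pos by (simp add: rho_val_def)

lemma X_weight_measurable [intro, simp]: "measurable_pos X_weight"
proof -
  have "measurable_pos (\<lambda>u. ennreal (u powr (- \<theta>)) * ennreal (b0 u))"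
    by (intro measurable_pos_mult measurable_pos_borel weight_measurable) auto
  then show ?thesis by (simp add: X_weight_def[abs_def] ennreal_mult')
qed

lemma inner_weight_measurable [intro, simp]: "measurable_pos inner_weight"
proof -
  have "measurable_pos (\<lambda>u. ennreal (u powr (- 1)) * ennreal (a1 u))"
    by (intro measurable_pos_mult measurable_pos_borel weight_measurable) auto
  then show ?thesis by (simp only: inner_weight_def[abs_def] ennreal_mult' powr_ge_zero)
qed

lemma inner_weight_eq: "0 < u \<Longrightarrow> inner_weight u = ennreal (a1 u) * ennreal (1 / u)"
  using SV_pos[OF a1, of u]
  by (subst ennreal_mult[symmetric]) (auto simp: inner_weight_def powr_minus_divide)

lemma inner_from_measurable [intro, simp]:
  assumes "measurable_pos k" "0 \<le> t"
  shows "measurable_pos (inner_from t k)"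
proof (rule measurable_pos_mono, rule monoI)
  fix s s' :: real assume "s \<le> s'"
  then show "inner_from t k s \<le> inner_from t k s'"
    unfolding inner_from_def using assms q1
    by (intro haar_norm_mono measurable_pos_mult) auto
qed

lemma inner_from_measurable' [intro, simp]:
  assumes "measurable_pos k" "0 \<le> t"
  shows "measurable_pos (\<lambda>s. inner_from t k s)"
  using inner_from_measurable[OF assms] .

lemma X_on_mono:
  assumes "S \<in> sets borel" "T \<in> sets borel" "S \<subseteq> T" "T \<subseteq> {0<..}" "measurable_pos k" "\<And>u. u \<in> S \<Longrightarrow> k u
      \<le> k' u"
  shows "X_on S k \<le> X_on T k'"
  unfolding X_on_def using assms r0
  by (intro haar_norm_mono measurable_pos_mult mult_left_mono) auto

lemma X_on_cmult_le:
  assumes "S \<in> sets borel" "S \<subseteq> {0<..}" "measurable_pos k"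
  shows "X_on S (\<lambda>u. c * k u) \<le> c * X_on S k"
  using haar_norm_cmult_le[OF r0 assms(1,2) measurable_pos_mult[OF X_weight_measurable assms(3)], of c]
  by (simp add: X_on_def mult.left_commute)

lemma inner_from_mono:
  assumes "measurable_pos k" "0 \<le> t'" "t' \<le> t" "\<And>u. t < u \<Longrightarrow> u < s \<Longrightarrow> k u \<le> k' u"
  shows "inner_from t k s \<le> inner_from t' k' s"
  unfolding inner_from_def using assms q1
  by (intro haar_norm_mono measurable_pos_mult mult_left_mono) auto

lemma Y_from_mono:
  assumes "measurable_pos k" "0 \<le> t'" "t' \<le> t" "\<And>u. t < u \<Longrightarrow> k u \<le> k' u"
  shows "Y_from t k \<le> Y_from t' k'"
  unfolding Y_from_def using assms r1
  by (intro haar_norm_mono measurable_pos_mult mult_left_mono inner_from_mono) auto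

lemma inner_from_cmult_le:
  assumes "measurable_pos k" "0 \<le> t"
  shows "inner_from t (\<lambda>u. c * k u) s \<le> c * inner_from t k s"
proof -
  have "haar_norm q1 {t<..<s} (\<lambda>u. c * (inner_weight u * k u))
      \<le> c * haar_norm q1 {t<..<s} (\<lambda>u. inner_weight u * k u)"
    using assms q1 by (intro haar_norm_cmult_le) auto
  then show ?thesis by (simp add: inner_from_def mult.left_commute)
qed

lemma Y_from_cmult_le:
  assumes "measurable_pos k" "0 \<le> t"
  shows "Y_from t (\<lambda>u. c * k u) \<le> c * Y_from t k"
proof -
  have "Y_from t (\<lambda>u. c * k u) \<le> haar_norm r1 {t<..} (\<lambda>s. c * (ennreal (b1 s) * inner_from t k s))"
    unfolding Y_from_def using assms r1
    by (intro haar_norm_mono measurable_pos_mult inner_from_measurable)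
       (auto simp: mult.left_commute[of c] intro!: mult_left_mono inner_from_cmult_le)
  also have "\<dots> \<le> c * Y_from t k"
    unfolding Y_from_def using assms r1 by (intro haar_norm_cmult_le) auto
  finally show ?thesis .
qed

lemma X_on_add_le:
  "\<exists>C<\<infinity>. \<forall>S k k'. S \<in> sets borel \<longrightarrow> S \<subseteq> {0<..} \<longrightarrow> measurable_pos k \<longrightarrow> measurable_pos k' \<longrightarrow>
    X_on S (\<lambda>u. k u + k' u) \<le> C * (X_on S k + X_on S k')"
proof -
  obtain C where C: "C < \<infinity>" "\<And>S F G. S \<in> sets borel \<Longrightarrow> S \<subseteq> {0<..} \<Longrightarrow> measurable_pos F \<Longrightarrow> measurable_pos G \<Longrightarrow>
    haar_norm r0 S (\<lambda>u. F u + G u) \<le> C * (haar_norm r0 S F + haar_norm r0 S G)"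
    using haar_norm_add_le[OF r0] by meson
  show ?thesis
    unfolding X_on_def distrib_left[of "X_weight _"]
    by (intro exI[of _ C] conjI C(1) allI impI C(2) measurable_pos_mult X_weight_measurable)
qed

lemma inner_from_add_le:
  "\<exists>C<\<infinity>. \<forall>t\<ge>0. \<forall>k k' s. measurable_pos k \<longrightarrow> measurable_pos k' \<longrightarrow>
    inner_from t (\<lambda>u. k u + k' u) s \<le> C * (inner_from t k s + inner_from t k' s)"
proof -
  obtain C where C: "C < \<infinity>" "\<And>S F G. S \<in> sets borel \<Longrightarrow> S \<subseteq> {0<..} \<Longrightarrow> measurable_pos F \<Longrightarrow> measurable_pos G \<Longrightarrow>
    haar_norm q1 S (\<lambda>u. F u + G u) \<le> C * (haar_norm q1 S F + haar_norm q1 S G)"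
    using haar_norm_add_le[OF q1] by meson
  show ?thesis
    unfolding inner_from_def distrib_left[of "inner_weight _"]
    by (intro exI[of _ C] conjI C(1) allI impI C(2) measurable_pos_mult inner_weight_measurable) auto
qed

lemma Y_from_add_le:
  "\<exists>C<\<infinity>. \<forall>t\<ge>0. \<forall>k k'. measurable_pos k \<longrightarrow> measurable_pos k' \<longrightarrow>
    Y_from t (\<lambda>u. k u + k' u) \<le> C * (Y_from t k + Y_from t k')"
proof -
  obtain C where C: "C < \<infinity>" "\<And>t k k' s. t \<ge> 0 \<Longrightarrow> measurable_pos k \<Longrightarrow> measurable_pos k' \<Longrightarrow>
    inner_from t (\<lambda>u. k u + k' u) s \<le> C * (inner_from t k s + inner_from t k' s)"
    using inner_from_add_le by meson
  obtain D where D: "D < \<infinity>" "\<And>S F G. S \<in> sets borel \<Longrightarrow> S \<subseteq> {0<..} \<Longrightarrow> measurable_pos F \<Longrightarrow> measurable_pos G \<Longrightarrow>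
    haar_norm r1 S (\<lambda>u. F u + G u) \<le> D * (haar_norm r1 S F + haar_norm r1 S G)"
    using haar_norm_add_le[OF r1] by meson
  have "Y_from t (\<lambda>u. k u + k' u) \<le> C * D * (Y_from t k + Y_from t k')"
    if t: "t \<ge> 0" and k: "measurable_pos k" "measurable_pos k'" for t k k'
  proof -
    let ?F = "\<lambda>s. ennreal (b1 s) * inner_from t k s + ennreal (b1 s) * inner_from t k' s"
    have F: "measurable_pos ?F"
      by (intro measurable_pos_add measurable_pos_mult weight_measurable inner_from_measurable' t k)
    have "ennreal (b1 s) * inner_from t (\<lambda>u. k u + k' u) s \<le> C * ?F s" for s
      using mult_left_mono[OF C(2)[OF t k], of "ennreal (b1 s)" s] by (simp add: algebra_simps)
    then have "Y_from t (\<lambda>u. k u + k' u) \<le> haar_norm r1 {t<..} (\<lambda>s. C * ?F s)"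
      unfolding Y_from_def using r1 t
      by (intro haar_norm_mono)
         (auto intro!: measurable_pos_mult[OF weight_measurable(2)] inner_from_measurable'
             measurable_pos_add k)
    also have "\<dots> \<le> C * haar_norm r1 {t<..} ?F"
      using r1 t F by (intro haar_norm_cmult_le) auto
    also have "\<dots> \<le> C * (D * (Y_from t k + Y_from t k'))"
      unfolding Y_from_def using t
      by (intro mult_left_mono D) (auto intro!: measurable_pos_mult[OF weight_measurable(2)]
          inner_from_measurable' k)
    finally show ?thesis by (simp add: mult.assoc)
  qed
  moreover have "C * D < \<infinity>" using C(1) D(1) by (simp add: ennreal_mult_less_top)
  ultimately show ?thesis by blast
qed

text \<open>
  On \<open>(t/2,t)\<close> every factor of the integrand is comparable with its value at \<open>t\<close>, the factor \<open>k\<close> by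
  quasi-concavity.
\<close>

lemma point_le_X_on:
  "\<exists>C<\<infinity>. \<forall>t>0. \<forall>k. quasi_concave k \<longrightarrow> X_weight t * k t \<le> C * X_on {0<..<t} k"
proof -
  obtain C where C: "C < \<infinity>" "\<And>t. t > 0 \<Longrightarrow> ennreal (b0 t)
      \<le> C * haar_norm r0 {t/2<..<t} (\<lambda>u. ennreal (b0 u))"
    using SV_haar_lower[OF b0 r0] by blast
  have "X_weight t * k t \<le> C * 2 * X_on {0<..<t} k" if t: "t > 0" and k: "quasi_concave k" for t k
  proof -
    let ?c = "ennreal (t powr (- \<theta>)) * k t"
    have fin: "?c < \<infinity>" using k t by (simp add: quasi_concave_def ennreal_mult_less_top)
    have W: "X_weight u = ennreal (u powr (- \<theta>)) * ennreal (b0 u)" for u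
      by (simp add: X_weight_def ennreal_mult')
    have "X_weight t * k t = ?c * ennreal (b0 t)"
      by (simp add: W mult_ac)
    also have "\<dots> \<le> ?c * (C * haar_norm r0 {t/2<..<t} (\<lambda>u. ennreal (b0 u)))"
      by (intro mult_left_mono C t) auto
    also have "\<dots> = C * haar_norm r0 {t/2<..<t} (\<lambda>u. ?c * ennreal (b0 u))"
      using t r0 fin by (subst haar_norm_cmult) (auto simp: mult_ac)
    also have "\<dots> \<le> C * haar_norm r0 {0<..<t} (\<lambda>u. 2 * (X_weight u * k u))"
    proof (intro mult_left_mono haar_norm_mono)
      fix u assume "u \<in> {t/2<..<t}"
      then have u: "0 < u" "u \<le> t" "t / u \<le> 2" using t by (auto simp: field_simps)
      have "k t \<le> ennreal (t / u) * k u" using k u by (simp add: quasi_concave_def)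
      also have "\<dots> \<le> ennreal 2 * k u" using u by (intro mult_right_mono ennreal_leI) auto
      finally have "k t \<le> 2 * k u" by simp
      moreover have "ennreal (t powr (- \<theta>)) \<le> ennreal (u powr (- \<theta>))"
        using u \<theta> by (intro ennreal_leI powr_mono2') auto
      ultimately have "?c * ennreal (b0 u) \<le> (ennreal (u powr (- \<theta>)) * (2 * k u)) * ennreal (b0 u)"
        by (intro mult_right_mono mult_mono) auto
      then show "?c * ennreal (b0 u) \<le> 2 * (X_weight u * k u)"
        by (simp add: W mult_ac)
    qed (use t r0 k in auto)
    also have "\<dots> \<le> C * (2 * X_on {0<..<t} k)"
      unfolding X_on_def using r0 k t by (intro mult_left_mono haar_norm_cmult_le) auto
    finally show ?thesis by (simp add: mult.assoc)
  qed
  moreover have "C * 2 < \<infinity>" using C(1) by (simp add: ennreal_mult_less_top)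
  ultimately show ?thesis by blast
qed

text \<open>
  This is the estimate for the \<open>A0\<close>-part of an almost optimal decomposition.  Beyond \<open>t\<close> the bound
      is constant and
  \<open>\<theta> > 0\<close> makes the weight decay, so that the tail costs only the value at \<open>t\<close>.
\<close>

lemma X_on_truncation_le:
  "\<exists>C<\<infinity>. \<forall>t>0. \<forall>k k0. quasi_concave k \<longrightarrow> measurable_pos k0 \<longrightarrow>
    (\<forall>u>0. k0 u \<le> k (min u t)) \<longrightarrow> X_on {0<..} k0 \<le> C * X_on {0<..<t} k"
proof -
  obtain C where C: "C < \<infinity>" "\<And>t k. t > 0 \<Longrightarrow> quasi_concave k \<Longrightarrow>
     X_weight t * k t \<le> C * X_on {0<..<t} k"
    using point_le_X_on by blast
  obtain D where D: "D > 0" "\<And>u t. u > 0 \<Longrightarrow> t \<ge> u \<Longrightarrow> b0 t \<le> D * (t / u) powr (\<theta> / 2) * b0 u"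
    using SV_Potter[OF b0, of "\<theta> / 2"] \<theta> by auto
  have t2: "\<theta> / 2 > 0" using \<theta> by simp
  obtain E where E: "E < \<infinity>" "\<And>t S F c. t > 0 \<Longrightarrow> S \<in> sets borel \<Longrightarrow> measurable_pos F \<Longrightarrow>
     S \<subseteq> {t<..} \<Longrightarrow> (\<forall>u\<in>S. F u \<le> c * ennreal ((t / u) powr (\<theta> / 2))) \<Longrightarrow> haar_norm r0 S F \<le> E * c"
    using haar_norm_growth_above[OF r0 t2] by meson
  obtain G where G: "G < \<infinity>" "\<And>S T U F. S \<in> sets borel \<Longrightarrow> T \<in> sets borel \<Longrightarrow> U \<in> sets borel \<Longrightarrow> 
     S \<subseteq> {0<..} \<Longrightarrow> T \<subseteq> {0<..} \<Longrightarrow> U \<subseteq> {0<..} \<Longrightarrow> measurable_pos F \<Longrightarrow> finite (U - (S \<union> T)) \<Longrightarrow>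
    haar_norm r0 U F \<le> G * (haar_norm r0 S F + haar_norm r0 T F)"
    using haar_norm_split_le[OF r0] by meson
  have "X_on {0<..} k0 \<le> G * (1 + E * ennreal D * C) * X_on {0<..<t} k"
    if t: "t > 0" and k: "quasi_concave k" "measurable_pos k0" and le: "\<forall>u>0. k0 u \<le> k (min u t)"
        for t k k0
  proof -
    have 1: "X_on {0<..<t} k0 \<le> X_on {0<..<t} k"
      using k by (intro X_on_mono) (auto simp: le[rule_format] intro: order_trans[OF le[rule_format]])
    have "X_on {t<..} k0 \<le> E * (ennreal D * (X_weight t * k t))"
      unfolding X_on_def
    proof (rule E(2)[OF t])
      show "\<forall>u\<in>{t<..}. X_weight u * k0 u
        \<le> ennreal D * (X_weight t * k t) * ennreal ((t / u) powr (\<theta> / 2))"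
      proof
        fix u assume "u \<in> {t<..}"
        then have u: "t < u" "0 < u" using t by auto
        have "k0 u \<le> k t" using le u by (metis min.strict_order_iff min.commute)
        moreover have "u powr (- \<theta>) * b0 u \<le> D * (t powr (- \<theta>) * b0 t) * (t / u) powr (\<theta> / 2)"
        proof -
          have "u powr (- \<theta>) * (u / t) powr (\<theta> / 2) = t powr (- \<theta>) * (t / u) powr (\<theta> / 2)"
          proof -
            have "u powr \<theta> = u powr (\<theta> / 2) * u powr (\<theta> / 2)" "t powr \<theta>
                = t powr (\<theta> / 2) * t powr (\<theta> / 2)"
              by (simp_all flip: powr_add)
            then show ?thesis using u t by (simp add: powr_divide powr_minus field_simps)
          qed
          note eq = this
          have "u powr (- \<theta>) * b0 u \<le> u powr (- \<theta>) * (D * (u / t) powr (\<theta> / 2) * b0 t)"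
            using u t by (intro mult_left_mono D) auto
          also have "\<dots> = D * b0 t * (u powr (- \<theta>) * (u / t) powr (\<theta> / 2))"
            by (simp only: mult_ac)
          also have "\<dots> = D * (t powr (- \<theta>) * b0 t) * (t / u) powr (\<theta> / 2)"
            unfolding eq by (simp only: mult_ac)
          finally show ?thesis .
        qed
        ultimately have "X_weight u * k0 u
          \<le> ennreal (D * (t powr (- \<theta>) * b0 t) * (t / u) powr (\<theta> / 2)) * k t"
          unfolding X_weight_def by (intro mult_mono[OF ennreal_leI]) auto
        then show "X_weight u * k0 u
          \<le> ennreal D * (X_weight t * k t) * ennreal ((t / u) powr (\<theta> / 2))"
          using D(1) SV_pos[OF b0 t] by (simp add: X_weight_def ennreal_mult mult_ac)
      qed
    qed (use t k in auto)
    also have "\<dots> \<le> E * (ennreal D * (C * X_on {0<..<t} k))"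
      using t k by (intro mult_left_mono C) auto
    finally have 2: "X_on {t<..} k0 \<le> E * ennreal D * C * X_on {0<..<t} k" by (simp add: mult_ac)
    have "{0<..} - ({0<..<t} \<union> {t<..}) \<subseteq> {t}" by auto
    then have "X_on {0<..} k0 \<le> G * (X_on {0<..<t} k0 + X_on {t<..} k0)"
      unfolding X_on_def using t k by (intro G) (auto intro: finite_subset)
    also have "\<dots> \<le> G * (X_on {0<..<t} k + E * ennreal D * C * X_on {0<..<t} k)"
      by (intro mult_left_mono add_mono 1 2) auto
    finally show ?thesis by (simp add: algebra_simps)
  qed
  moreover have "G * (1 + E * ennreal D * C) < \<infinity>"
    using C(1) E(1) G(1) by (simp add: ennreal_mult_less_top)
  ultimately show ?thesis by blast
qed

text \<open>
  The weight \<open>1/u\<close> of the limiting space cancels a linear function, leaving \<open>Phi\<close>.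
\<close>

lemma inner_from_linear_le:
  assumes "measurable_pos k1" "0 < s" "\<And>u. 0 < u \<Longrightarrow> u < s \<Longrightarrow> k1 u \<le> ennreal u * c"
  shows "inner_from 0 k1 s \<le> c * Phi s"
proof -
  have "inner_from 0 k1 s \<le> haar_norm q1 {0<..<s} (\<lambda>u. c * ennreal (a1 u))"
    unfolding inner_from_def
  proof (intro haar_norm_mono)
    fix u assume u: "u \<in> {0<..<s}"
    have "inner_weight u * k1 u \<le> inner_weight u * (ennreal u * c)"
      using u assms by (intro mult_left_mono) auto
    also have "\<dots> = c * (inner_weight u * ennreal u)" by (simp add: mult_ac)
    also have "inner_weight u * ennreal u = ennreal (a1 u)"
      using u SV_pos[OF a1, of u] by (simp add: inner_weight_eq flip: ennreal_mult)
    finally show "inner_weight u * k1 u \<le> c * ennreal (a1 u)" .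
  qed (use assms q1 in auto)
  also have "\<dots> \<le> c * Phi s"
    unfolding Phi_def using q1 by (intro haar_norm_cmult_le) auto
  finally show ?thesis .
qed

text \<open>
  This is the estimate for the \<open>A1\<close>-part.  A linear start with slope \<open>k t / t\<close> contributes \<open>Chi t\<close>
  times the slope: the first summand of \<open>Chi\<close> comes from \<open>s < t\<close>, the second from \<open>s > t\<close>.  By the choice
  of \<open>rho_val\<close> this contribution equals a term already bounded by \<open>point_le_X_on\<close>.
\<close>

lemma Y_from_truncation_le:
  "\<exists>C<\<infinity>. \<forall>t>0. \<forall>k k1. quasi_concave k \<longrightarrow> measurable_pos k1 \<longrightarrow>
    (\<forall>u>0. u \<le> t \<longrightarrow> k1 u \<le> ennreal u * (k t * ennreal (1 / t))) \<longrightarrow> (\<forall>u>t. k1 u \<le> k u) \<longrightarrow>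
    ennreal (rho_val t) * Y_from 0 k1 \<le> C * (X_on {0<..<t} k + ennreal (rho_val t) * Y_from t k)"
proof -
  obtain C where C: "C < \<infinity>" "\<And>t k. t > 0 \<Longrightarrow> quasi_concave k \<Longrightarrow>
     X_weight t * k t \<le> C * X_on {0<..<t} k"
    using point_le_X_on by blast
  obtain D where D: "D < \<infinity>" "\<And>S T U F. S \<in> sets borel \<Longrightarrow> T \<in> sets borel \<Longrightarrow> U \<in> sets borel \<Longrightarrow> 
     S \<subseteq> {0<..} \<Longrightarrow> T \<subseteq> {0<..} \<Longrightarrow> U \<subseteq> {0<..} \<Longrightarrow> measurable_pos F \<Longrightarrow> finite (U - (S \<union> T)) \<Longrightarrow>
    haar_norm q1 U F \<le> D * (haar_norm q1 S F + haar_norm q1 T F)"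
    using haar_norm_split_le[OF q1] by meson
  obtain G where G: "G < \<infinity>" "\<And>S T U F. S \<in> sets borel \<Longrightarrow> T \<in> sets borel \<Longrightarrow> U \<in> sets borel \<Longrightarrow> 
     S \<subseteq> {0<..} \<Longrightarrow> T \<subseteq> {0<..} \<Longrightarrow> U \<subseteq> {0<..} \<Longrightarrow> measurable_pos F \<Longrightarrow> finite (U - (S \<union> T)) \<Longrightarrow>
    haar_norm r1 U F \<le> G * (haar_norm r1 S F + haar_norm r1 T F)"
    using haar_norm_split_le[OF r1] by meson
  obtain E where E: "E < \<infinity>" "\<And>S F G. S \<in> sets borel \<Longrightarrow> S \<subseteq> {0<..} \<Longrightarrow> measurable_pos F \<Longrightarrow> measurable_pos G \<Longrightarrow>
    haar_norm r1 S (\<lambda>u. F u + G u) \<le> E * (haar_norm r1 S F + haar_norm r1 S G)"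
    using haar_norm_add_le[OF r1] by meson
  define M where "M = G * (1 + D * E)"
  have M: "M < \<infinity>" using D(1) E(1) G(1) by (simp add: M_def ennreal_mult_less_top)
  have "ennreal (rho_val t) * Y_from 0 k1 \<le> M * (C + 1) * (X_on {0<..<t} k + ennreal (rho_val t) *
      Y_from t k)"
    if t: "t > 0" and k: "quasi_concave k" "measurable_pos k1"
      and lo: "\<forall>u>0. u \<le> t \<longrightarrow> k1 u \<le> ennreal u * (k t * ennreal (1 / t))" and hi: "\<forall>u>t. k1 u \<le> k u"
          for t k k1
  proof -
    define c where "c = k t * ennreal (1 / t)"
    let ?H = "haar_norm r1 {0<..<t} (\<lambda>s. ennreal (b1 s) * Phi s)"
    let ?F = "\<lambda>s. ennreal (b1 s) * inner_from 0 k1 s"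
    have inner0: "inner_from 0 k1 s \<le> c * Phi s" if "0 < s" "s \<le> t" for s
      using that k lo by (intro inner_from_linear_le) (auto simp: c_def)
    have head: "haar_norm r1 {0<..<t} ?F \<le> c * ?H"
    proof -
      have "haar_norm r1 {0<..<t} ?F \<le> haar_norm r1 {0<..<t} (\<lambda>s. c * (ennreal (b1 s) * Phi s))"
        using r1 k inner0 by (intro haar_norm_mono)
            (auto simp: mult.left_commute[of c] intro!: mult_left_mono)
      also have "\<dots> \<le> c * ?H" using r1 by (intro haar_norm_cmult_le) auto
      finally show ?thesis .
    qed
    have tail: "haar_norm r1 {t<..} ?F \<le> D * E * (c * (tail t * Phi t) + Y_from t k)"
    proof -
      have inner: "inner_from 0 k1 s \<le> D * (c * Phi t + inner_from t k s)" if s: "s > t" for s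
      proof -
        have "{0<..<s} - ({0<..<t} \<union> {t<..<s}) \<subseteq> {t}" by auto
        then have "inner_from 0 k1 s \<le> D * (inner_from 0 k1 t + inner_from t k1 s)"
          unfolding inner_from_def using t s k by (intro D) (auto intro: finite_subset)
        also have "\<dots> \<le> D * (c * Phi t + inner_from t k s)"
          using k t hi by (intro mult_left_mono add_mono inner0 inner_from_mono) auto
        finally show ?thesis .
      qed
      let ?P = "\<lambda>s. (c * Phi t) * ennreal (b1 s)" and ?Q = "\<lambda>s. ennreal (b1 s) * inner_from t k s"
      have meas: "measurable_pos ?P" "measurable_pos ?Q"
        using t by (auto intro!: measurable_pos_mult inner_from_measurable'
            quasi_concave_measurable[OF k(1)])
      have "haar_norm r1 {t<..} ?F \<le> haar_norm r1 {t<..} (\<lambda>s. D * (?P s + ?Q s))"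
      proof (intro haar_norm_mono)
        fix s assume "s \<in> {t<..}"
        then have "?F s \<le> ennreal (b1 s) * (D * (c * Phi t + inner_from t k s))"
          by (intro mult_left_mono inner) auto
        then show "?F s \<le> D * (?P s + ?Q s)" by (simp add: algebra_simps)
      qed (use t k r1 in auto)
      also have "\<dots> \<le> D * haar_norm r1 {t<..} (\<lambda>s. ?P s + ?Q s)"
        using r1 t meas by (intro haar_norm_cmult_le) auto
      also have "\<dots> \<le> D * (E * (haar_norm r1 {t<..} ?P + haar_norm r1 {t<..} ?Q))"
        using t meas by (intro mult_left_mono E) auto
      also have "\<dots> \<le> D * (E * ((c * Phi t) * tail t + Y_from t k))"
        unfolding tail_def Y_from_def using r1 t
        by (intro mult_left_mono add_mono haar_norm_cmult_le) auto
      finally show ?thesis by (simp add: mult_ac)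
    qed
    have "{0<..} - ({0<..<t} \<union> {t<..}) \<subseteq> {t}" by auto
    then have "Y_from 0 k1 \<le> G * (haar_norm r1 {0<..<t} ?F + haar_norm r1 {t<..} ?F)"
      unfolding Y_from_def using t k by (intro G) (auto intro: finite_subset)
    also have "\<dots> \<le> G * (c * ?H + D * E * (c * (tail t * Phi t) + Y_from t k))"
      by (intro mult_left_mono add_mono head tail) auto
    also have "\<dots> \<le> G * ((1 + D * E) * (c * ?H) + (1 + D * E) * (c * (tail t * Phi t) + Y_from t k))"
      by (intro mult_left_mono add_mono mult_right_mono) (auto simp: distrib_right)
    also have "\<dots> = M * (c * Chi t + Y_from t k)"
      by (simp add: M_def Chi_def algebra_simps)
    finally have Y: "Y_from 0 k1 \<le> M * (c * Chi t + Y_from t k)" .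
    have "ennreal (rho_val t) * (c * Chi t) = k t * (ennreal (rho_val t) * ennreal (1 / t) * ennreal
        (chi_val t))"
      using t by (simp add: c_def ennreal_chi_val mult_ac)
    also have "ennreal (rho_val t) * ennreal (1 / t) * ennreal (chi_val t)
        = ennreal (rho_val t * (1 / t) * chi_val t)"
      using rho_val_pos[OF t] chi_val_pos[OF t] t by (subst ennreal_mult[symmetric]; simp)+
    also have "rho_val t * (1 / t) * chi_val t = t powr (- \<theta>) * b0 t"
    proof -
      have "t powr (1 - \<theta>) = t powr (- \<theta>) * t"
        using t powr_add[of t "- \<theta>" 1] by simp
      then show ?thesis using chi_val_pos[OF t] t by (simp add: rho_val_def)
    qed
    also have "ennreal (t powr (- \<theta>) * b0 t) = X_weight t" by (simp add: X_weight_def)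
    finally have id: "ennreal (rho_val t) * (c * Chi t) = X_weight t * k t"
      by (simp add: mult.commute)
    have "ennreal (rho_val t) * Y_from 0 k1 \<le> ennreal (rho_val t) * (M * (c * Chi t + Y_from t k))"
      by (intro mult_left_mono Y) auto
    also have "\<dots> = M * (ennreal (rho_val t) * (c * Chi t) + ennreal (rho_val t) * Y_from t k)"
      by (simp add: algebra_simps)
    also have "\<dots> \<le> M * (C * X_on {0<..<t} k + ennreal (rho_val t) * Y_from t k)"
      unfolding id using t k by (intro mult_left_mono add_mono C) auto
    also have "\<dots> \<le> M * ((C + 1) * X_on {0<..<t} k + (C + 1) * (ennreal (rho_val t) * Y_from t k))"
      by (intro mult_left_mono add_mono) (auto simp: distrib_right)
    finally show ?thesis by (simp add: algebra_simps)
  qed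
  moreover have "M * (C + 1) < \<infinity>" using C(1) M by (simp add: ennreal_mult_less_top)
  ultimately show ?thesis by blast
qed

text \<open>
  Below \<open>u\<close>, the function \<open>h\<close> lies above the linear function of slope \<open>h u / u\<close>, whose contribution to
  the quasi-norm is again the slope times \<open>Chi u\<close>.
\<close>

lemma quasi_concave_le_Y_from:
  assumes h: "quasi_concave h" and u: "0 < u"
  shows "h u \<le> ennreal (u / chi_val u) * (2 * Y_from 0 h)"
proof -
  define c where "c = h u * ennreal (1 / u)"
  have c: "c < \<infinity>" using h u by (simp add: c_def quasi_concave_def ennreal_mult_less_top)
  have inner: "c * Phi s \<le> inner_from 0 h s" if s: "s \<le> u" for s
  proof -
    have "c * Phi s = haar_norm q1 {0<..<s} (\<lambda>v. c * ennreal (a1 v))"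
      unfolding Phi_def using q1 c by (intro haar_norm_cmult[symmetric]) auto
    also have "\<dots> \<le> inner_from 0 h s"
      unfolding inner_from_def
    proof (intro haar_norm_mono)
      fix v assume v: "v \<in> {0<..<s}"
      have "c * ennreal (a1 v) \<le> (h v * ennreal (1 / v)) * ennreal (a1 v)"
        unfolding c_def using v s h by (intro mult_right_mono quasi_concave_ratio) auto
      also have "\<dots> = inner_weight v * h v"
        using v by (simp add: inner_weight_eq mult_ac)
      finally show "c * ennreal (a1 v) \<le> inner_weight v * h v" .
    qed (use q1 in auto)
    finally show ?thesis .
  qed
  have "c * haar_norm r1 {0<..<u} (\<lambda>s. ennreal (b1 s) * Phi s)
      = haar_norm r1 {0<..<u} (\<lambda>s. c * (ennreal (b1 s) * Phi s))"
    using r1 c by (intro haar_norm_cmult[symmetric]) auto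
  also have "\<dots> \<le> Y_from 0 h"
    unfolding Y_from_def using r1 u inner
    by (intro haar_norm_mono measurable_pos_mult measurable_pos_const)
       (auto simp: mult.left_commute[of c] intro!: mult_left_mono)
  finally have 1: "c * haar_norm r1 {0<..<u} (\<lambda>s. ennreal (b1 s) * Phi s) \<le> Y_from 0 h" .
  have "c * (tail u * Phi u) = (c * Phi u) * tail u" by (simp add: mult_ac)
  also have "\<dots> = haar_norm r1 {u<..} (\<lambda>s. (c * Phi u) * ennreal (b1 s))"
    unfolding tail_def using r1 c u Phi_finite[OF u]
    by (intro haar_norm_cmult[symmetric]) (auto simp: ennreal_mult_less_top)
  also have "\<dots> \<le> Y_from 0 h"
    unfolding Y_from_def
  proof (intro haar_norm_mono)
    fix s assume s: "s \<in> {u<..}"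
    have "c * Phi u \<le> inner_from 0 h u" by (rule inner) simp
    also have "\<dots> \<le> inner_from 0 h s"
      unfolding inner_from_def using s q1 h by (intro haar_norm_mono) auto
    finally show "c * Phi u * ennreal (b1 s) \<le> ennreal (b1 s) * inner_from 0 h s"
      by (simp add: mult.commute mult_left_mono)
  qed (use r1 u in auto)
  finally have 2: "c * (tail u * Phi u) \<le> Y_from 0 h" .
  have "c * Chi u \<le> 2 * Y_from 0 h"
    unfolding Chi_def distrib_left mult_2 by (intro add_mono 1 2)
  moreover have "h u = ennreal (u / chi_val u) * (c * Chi u)"
  proof -
    have "ennreal (u / chi_val u) * (ennreal (1 / u) * ennreal (chi_val u))
        = ennreal (u / chi_val u * (1 / u * chi_val u))"
      using u chi_val_pos[OF u] by (simp only: ennreal_mult divide_nonneg_nonneg mult_nonneg_nonneg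
          less_imp_le zero_le_one)
    also have "\<dots> = 1" using u chi_val_pos[OF u] by simp
    finally have "h u = h u * (ennreal (u / chi_val u) * (ennreal (1 / u) * Chi u))"
      using u by (simp add: ennreal_chi_val)
    then show ?thesis by (simp add: c_def mult_ac)
  qed
  ultimately show ?thesis by (simp add: mult_left_mono)
qed

text \<open>
  First cross term: the pointwise bound leaves a weight that decays like a power towards \<open>0\<close>,
  because \<open>\<theta> < 1\<close> beats the slow variation of \<open>b0\<close> and \<open>Chi\<close>.
\<close>

lemma X_on_le_Y_from:
  "\<exists>C<\<infinity>. \<forall>t>0. \<forall>h. quasi_concave h \<longrightarrow> X_on {0<..<t} h \<le> C * (ennreal (rho_val t) * Y_from 0 h)"
proof -
  \<comment> \<open>Two Potter bounds cost the power \<open>2 * e\<close>, half of the available \<open>1 - \<theta>\<close>.\<close>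
  define e where "e = (1 - \<theta>) / 4"
  have e: "e > 0" "2 * e > 0" using \<theta> by (simp_all add: e_def)
  obtain C where C: "C > 0" "\<And>u t. u > 0 \<Longrightarrow> t \<ge> u \<Longrightarrow> b0 u \<le> C * (t / u) powr e * b0 t"
    using SV_Potter[OF b0 e(1)] by auto
  obtain D where D: "D > 0" "\<And>u t. u > 0 \<Longrightarrow> t \<ge> u \<Longrightarrow> chi_val t \<le> D * (t / u) powr e * chi_val u"
    using chi_val_growth[OF e(1)] by auto
  obtain E where E: "E < \<infinity>" "\<And>t S F c. t > 0 \<Longrightarrow> S \<in> sets borel \<Longrightarrow> measurable_pos F \<Longrightarrow>
     S \<subseteq> {0<..<t} \<Longrightarrow> (\<forall>u\<in>S. F u \<le> c * ennreal ((u / t) powr (2 * e))) \<Longrightarrow> haar_norm r0 S F \<le> E * c"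
    using haar_norm_growth_below[OF r0 e(2)] by meson
  have weight: "u powr (- \<theta>) * b0 u * (u / chi_val u) \<le> C * D * rho_val t * (u / t) powr (2 * e)"
    if u: "0 < u" and ut: "u \<le> t" for u t
  proof -
    have t: "0 < t" using u ut by simp
    note pos = chi_val_pos[OF u] chi_val_pos[OF t] SV_pos[OF b0 u] SV_pos[OF b0 t]
    have inv: "1 / chi_val u \<le> D * (t / u) powr e / chi_val t"
      using D(2)[OF u ut] pos by (simp add: field_simps)
    have "u powr (- \<theta>) * b0 u * (u / chi_val u) = u powr (1 - \<theta>) * (b0 u * (1 / chi_val u))"
      using u by (simp add: powr_diff powr_minus field_simps)
    also have "\<dots> \<le> u powr (1 - \<theta>) * ((C * (t / u) powr e * b0 t) * (D * (t / u) powr e / chi_val t))"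
      using pos C(1) by (intro mult_left_mono mult_mono inv C(2) u ut) auto
    also have "\<dots> = C * D * (u powr (1 - \<theta>) * ((t / u) powr e * (t / u) powr e)) * b0 t / chi_val t"
      by simp
    also have "u powr (1 - \<theta>) * ((t / u) powr e * (t / u) powr e)
        = t powr (1 - \<theta>) * (u / t) powr (2 * e)"
    proof -
      have "1 - \<theta> = 2 * e + 2 * e" by (simp add: e_def)
      then have "u powr (1 - \<theta>) = u powr (2 * e) * u powr (2 * e)" "t powr (1 - \<theta>)
          = t powr (2 * e) * t powr (2 * e)"
        by (simp_all only: powr_add)
      moreover have "(t / u) powr e * (t / u) powr e = t powr (2 * e) / u powr (2 * e)"
        using u t by (simp add: powr_divide flip: powr_add) 
      moreover have "(u / t) powr (2 * e) = u powr (2 * e) / t powr (2 * e)"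
        using u t by (simp add: powr_divide)
      ultimately show ?thesis using u t by (simp add: field_simps)
    qed
    finally show ?thesis by (simp add: rho_val_def mult_ac)
  qed
  have "X_on {0<..<t} h \<le> E * (ennreal (C * D) * 2) * (ennreal (rho_val t) * Y_from 0 h)"
    if t: "0 < t" and h: "quasi_concave h" for t h
  proof -
    have "X_on {0<..<t} h \<le> E * (ennreal (C * D) * 2 * (ennreal (rho_val t) * Y_from 0 h))"
      unfolding X_on_def
    proof (rule E(2)[OF t])
      show "\<forall>u\<in>{0<..<t}. X_weight u * h u
        \<le> ennreal (C * D) * 2 * (ennreal (rho_val t) * Y_from 0 h) * ennreal ((u / t) powr (2 * e))"
      proof
        fix u assume "u \<in> {0<..<t}"
        then have u: "0 < u" "u \<le> t" by auto
        have "X_weight u * h u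
          \<le> X_weight u * (ennreal (u / chi_val u) * (2 * Y_from 0 h))"
          by (intro mult_left_mono quasi_concave_le_Y_from h u) auto
        also have "\<dots> = ennreal (u powr (- \<theta>) * b0 u * (u / chi_val u)) * (2 * Y_from 0 h)"
          using u SV_pos[OF b0 u(1)] chi_val_pos[OF u(1)]
          unfolding X_weight_def mult.assoc[symmetric] by (subst ennreal_mult[symmetric]) auto
        also have "\<dots> \<le> ennreal (C * D * rho_val t * (u / t) powr (2 * e)) * (2 * Y_from 0 h)"
          by (intro mult_right_mono ennreal_leI weight u) auto
        also have "\<dots> = ennreal (C * D) * 2 * (ennreal (rho_val t) * Y_from 0 h) * ennreal ((u / t)
            powr (2 * e))"
          using C(1) D(1) rho_val_pos[OF t] by (simp add: ennreal_mult mult_ac)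
        finally show "X_weight u * h u
          \<le> ennreal (C * D) * 2 * (ennreal (rho_val t) * Y_from 0 h) * ennreal ((u / t) powr (2 * e))" .
      qed
    qed (use h in auto)
    then show ?thesis by (simp add: mult.assoc)
  qed
  moreover have "E * (ennreal (C * D) * 2) < \<infinity>" using E(1) by (simp add: ennreal_mult_less_top)
  ultimately show ?thesis by blast
qed

text \<open>
  Second cross term: \<open>point_le_X_on\<close> bounds \<open>g\<close> pointwise, and the remaining weight decays like a
  power towards \<open>\<infinity>\<close>.  The inner quasi-norm is then bounded independently of \<open>s\<close>, so the outer one only
  contributes \<open>tail t\<close>.
\<close>

lemma Y_from_le_X_on:
  "\<exists>C<\<infinity>. \<forall>t>0. \<forall>g. quasi_concave g \<longrightarrow> ennreal (rho_val t) * Y_from t g \<le> C * X_on {0<..} g"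
proof -
  \<comment> \<open>Two Potter bounds cost the power \<open>2 * e\<close>, half of the available \<open>1 - \<theta>\<close>.\<close>
  define e where "e = (1 - \<theta>) / 4"
  have e: "e > 0" "2 * e > 0" using \<theta> by (simp_all add: e_def)
  obtain C where C: "C > 0" "\<And>u t. u > 0 \<Longrightarrow> t \<ge> u \<Longrightarrow> b0 u \<le> C * (t / u) powr e * b0 t"
    using SV_Potter[OF b0 e(1)] by auto
  obtain D where D: "D > 0" "\<And>u t. u > 0 \<Longrightarrow> t \<ge> u \<Longrightarrow> a1 t \<le> D * (t / u) powr e * a1 u"
    using SV_Potter[OF a1 e(1)] by auto
  obtain E where E: "E < \<infinity>" "\<And>t S F c. t > 0 \<Longrightarrow> S \<in> sets borel \<Longrightarrow> measurable_pos F \<Longrightarrow>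
     S \<subseteq> {t<..} \<Longrightarrow> (\<forall>u\<in>S. F u \<le> c * ennreal ((t / u) powr (2 * e))) \<Longrightarrow> haar_norm q1 S F \<le> E * c"
    using haar_norm_growth_above[OF q1 e(2)] by meson
  obtain P where P: "P < \<infinity>" "\<And>t k. t > 0 \<Longrightarrow> quasi_concave k \<Longrightarrow>
     X_weight t * k t \<le> P * X_on {0<..<t} k"
    using point_le_X_on by blast
  obtain A where A: "A < \<infinity>" "\<And>t. t > 0 \<Longrightarrow> ennreal (a1 t) \<le> A * Phi t"
    using a1_le_Phi by blast
  have weight: "u powr (- 1) * a1 u / (u powr (- \<theta>) * b0 u)
      \<le> C * D * (a1 t / (t powr (1 - \<theta>) * b0 t)) * (t / u) powr (2 * e)"
    if t: "0 < t" and tu: "t \<le> u" for u t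
  proof -
    have u: "0 < u" using t tu by simp
    note pos = SV_pos[OF b0 u] SV_pos[OF b0 t] SV_pos[OF a1 u] SV_pos[OF a1 t]
    have inv: "1 / b0 u \<le> C * (u / t) powr e / b0 t"
      using C(2)[OF t tu] pos by (simp add: field_simps)
    have "u powr (- 1) * a1 u / (u powr (- \<theta>) * b0 u) = u powr (\<theta> - 1) * (a1 u * (1 / b0 u))"
      using u by (simp add: powr_diff powr_minus field_simps)
    also have "\<dots> \<le> u powr (\<theta> - 1) * ((D * (u / t) powr e * a1 t) * (C * (u / t) powr e / b0 t))"
      using pos D(1) t u by (intro mult_left_mono mult_mono inv D(2) t tu) auto
    also have "\<dots> = C * D * (u powr (\<theta> - 1) * ((u / t) powr e * (u / t) powr e)) * a1 t / b0 t"
      by simp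
    also have "u powr (\<theta> - 1) * ((u / t) powr e * (u / t) powr e)
        = (t / u) powr (2 * e) / t powr (1 - \<theta>)"
    proof -
      have *: "1 - \<theta> = 2 * e + 2 * e" "\<theta> - 1 = - (2 * e + 2 * e)" by (simp_all add: e_def field_simps)
      then have eqs: "u powr (\<theta> - 1) = 1 / (u powr (2 * e) * u powr (2 * e))"
        "t powr (1 - \<theta>) = t powr (2 * e) * t powr (2 * e)"
        by (simp_all only: powr_add powr_minus_divide)
      have ratios: "(u / t) powr e * (u / t) powr e = u powr (2 * e) / t powr (2 * e)"
        "(t / u) powr (2 * e) = t powr (2 * e) / u powr (2 * e)"
        using u t by (simp_all add: powr_divide flip: powr_add)
      show ?thesis unfolding eqs ratios using u t by simp
    qed
    finally show ?thesis by (simp add: mult_ac)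
  qed
  have "ennreal (rho_val t) * Y_from t g \<le> (E * ennreal (C * D) * P * A) * X_on {0<..} g"
    if t: "0 < t" and g: "quasi_concave g" for t g
  proof -
    define w where "w = ennreal (a1 t / (t powr (1 - \<theta>) * b0 t))"
    define N where "N = P * X_on {0<..} g"
    define c where "c = E * (ennreal (C * D) * w * N)"
    have point: "X_weight u * g u \<le> N" if u: "u > 0" for u
      unfolding N_def using g
      by (intro order_trans[OF P(2)[OF u g]] mult_left_mono X_on_mono) auto
    have inner: "inner_from t g s \<le> c" for s
      unfolding inner_from_def c_def
    proof (rule E(2)[OF t])
      show "\<forall>u\<in>{t<..<s}. inner_weight u * g u \<le> ennreal (C * D) * w * N * ennreal ((t / u) powr (2 * e))"
      proof
        fix u assume "u \<in> {t<..<s}"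
        then have u: "0 < u" "t \<le> u" using t by auto
        have "inner_weight u =
            ennreal (u powr (- 1) * a1 u / (u powr (- \<theta>) * b0 u)) * X_weight u"
          using u SV_pos[OF b0 u(1)] SV_pos[OF a1 u(1)]
          unfolding X_weight_def inner_weight_def by (subst ennreal_mult[symmetric]) auto
        then have "inner_weight u * g u =
            ennreal (u powr (- 1) * a1 u / (u powr (- \<theta>) * b0 u)) * (X_weight u * g u)"
          by (simp add: mult.assoc)
        also have "\<dots> \<le> ennreal (C * D * (a1 t / (t powr (1 - \<theta>) * b0 t)) * (t / u) powr (2 * e)) * N"
          using u t by (intro mult_mono ennreal_leI weight point) auto
        also have "ennreal (C * D * (a1 t / (t powr (1 - \<theta>) * b0 t)) * (t / u) powr (2 * e))
            = ennreal (C * D) * w * ennreal ((t / u) powr (2 * e))"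
          using C(1) D(1) SV_pos[OF b0 t] SV_pos[OF a1 t] t unfolding w_def
          by (simp only: ennreal_mult mult_nonneg_nonneg divide_nonneg_nonneg less_imp_le powr_ge_zero)
        also have "ennreal (C * D) * w * ennreal ((t / u) powr (2 * e)) * N
            = ennreal (C * D) * w * N * ennreal ((t / u) powr (2 * e))"
          by (simp only: mult_ac)
        finally show "inner_weight u * g u \<le> ennreal (C * D) * w * N * ennreal ((t / u) powr (2 * e))" .
      qed
    qed (use t g in auto)
    have "Y_from t g \<le> haar_norm r1 {t<..} (\<lambda>s. c * ennreal (b1 s))"
      unfolding Y_from_def using r1 t quasi_concave_measurable[OF g] inner
      by (intro haar_norm_mono) (auto simp: mult.commute[of c] intro!: mult_left_mono)
    also have "\<dots> \<le> c * tail t"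
      unfolding tail_def using r1 t by (intro haar_norm_cmult_le) auto
    finally have "ennreal (rho_val t) * Y_from t g \<le> ennreal (rho_val t) * (c * tail t)"
      by (intro mult_left_mono) auto
    also have "\<dots> = E * ennreal (C * D) * N * ((ennreal (rho_val t) * w) * tail t)"
      by (simp add: c_def mult_ac)
    also have "(ennreal (rho_val t) * w) * tail t \<le> A"
    proof -
      have "rho_val t * (a1 t / (t powr (1 - \<theta>) * b0 t)) = a1 t * (1 / chi_val t)"
        using t SV_pos[OF b0 t] by (simp add: rho_val_def)
      then have "ennreal (rho_val t) * w = ennreal (a1 t) * ennreal (1 / chi_val t)"
        unfolding w_def using SV_pos[OF b0 t] SV_pos[OF a1 t] chi_val_pos[OF t] rho_val_pos[OF t]
        by (subst (1 2) ennreal_mult[symmetric]) auto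
      then have "(ennreal (rho_val t) * w) * tail t \<le> (A * Phi t) * ennreal (1 / chi_val t) * tail t"
        by (simp only:) (intro mult_right_mono A t; simp)
      also have "\<dots> = A * (ennreal (1 / chi_val t) * (tail t * Phi t))"
        by (simp only: mult_ac)
      also have "\<dots> \<le> A * (ennreal (1 / chi_val t) * ennreal (chi_val t))"
        unfolding ennreal_chi_val[OF t] by (intro mult_left_mono) (auto simp: Chi_def)
      also have "ennreal (1 / chi_val t) * ennreal (chi_val t) = 1"
        using chi_val_pos[OF t] by (subst ennreal_mult[symmetric]) auto
      finally show ?thesis by simp
    qed
    finally have "ennreal (rho_val t) * Y_from t g \<le> E * ennreal (C * D) * N * A"
      by (simp add: mult_left_mono)
    then show ?thesis by (simp only: N_def mult_ac)
  qed
  moreover have "E * ennreal (C * D) * P * A < \<infinity>"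
    using A(1) P(1) E(1) by (simp add: ennreal_mult_less_top)
  ultimately show ?thesis by blast
qed

end

section \<open>The K-functional of a compatible couple\<close>

lemma quasi_normed_zero:
  assumes "quasi_normed X" shows "0 \<in> carr X" "qnorm X 0 = 0"
  using assms by (auto simp: quasi_normed_def subspace_0)

lemma quasi_normed_uminus:
  assumes "quasi_normed X" "x \<in> carr X" shows "- x \<in> carr X" "qnorm X (- x) = qnorm X x"
proof -
  show "- x \<in> carr X" using assms by (auto simp: quasi_normed_def subspace_neg)
  have "qnorm X ((- 1) *\<^sub>R x) = \<bar>- 1\<bar> * qnorm X x"
    using assms unfolding quasi_normed_def by blast
  then show "qnorm X (- x) = qnorm X x" by simp
qed

lemma qnorm_nonneg: "quasi_normed X \<Longrightarrow> x \<in> carr X \<Longrightarrow> 0 \<le> qnorm X x"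
  by (auto simp: quasi_normed_def)

lemma quasi_triangle:
  assumes "quasi_normed X"
  shows "\<exists>C\<ge>1. \<forall>x\<in>carr X. \<forall>y\<in>carr X. qnorm X (x + y) \<le> C * (qnorm X x + qnorm X y)"
  using assms unfolding quasi_normed_def by (elim conjE)

lemma K_fun_le:
  "x \<in> carr X \<Longrightarrow> y \<in> carr Y \<Longrightarrow> K_fun t (x + y) X Y \<le> ennreal (qnorm X x + t * qnorm Y y)"
  unfolding K_fun_def by (intro Inf_lower) blast

lemma K_fun_le_left:
  assumes "quasi_normed Y" "x \<in> carr X" shows "K_fun t x X Y \<le> ennreal (qnorm X x)"
  using K_fun_le[OF assms(2) quasi_normed_zero(1)[OF assms(1)], of t] quasi_normed_zero[OF assms(1)]
      by simp

lemma K_fun_le_right: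
  assumes "quasi_normed X" "y \<in> carr Y" shows "K_fun t y X Y \<le> ennreal (t * qnorm Y y)"
  using K_fun_le[OF quasi_normed_zero(1)[OF assms(1)] assms(2), of t] quasi_normed_zero[OF assms(1)]
      by simp

lemma sum_carr_left: "quasi_normed Y \<Longrightarrow> x \<in> carr X \<Longrightarrow> x \<in> sum_carr X Y"
  using quasi_normed_zero(1)[of Y] unfolding sum_carr_def by force

lemma sum_carr_right: "quasi_normed X \<Longrightarrow> y \<in> carr Y \<Longrightarrow> y \<in> sum_carr X Y"
  using quasi_normed_zero(1)[of X] unfolding sum_carr_def by force

lemma sum_carr_add:
  assumes "quasi_normed X" "quasi_normed Y" "f \<in> sum_carr X Y" "g \<in> sum_carr X Y"
  shows "f + g \<in> sum_carr X Y"
proof -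
  obtain x y x' y' where "f = x + y" "g = x' + y'" "x \<in> carr X" "y \<in> carr Y" "x' \<in> carr X" "y' \<in> carr Y"
    using assms(3,4) by (auto simp: sum_carr_def)
  moreover have "(x + y) + (x' + y') = (x + x') + (y + y')" by (simp add: algebra_simps)
  moreover have "x + x' \<in> carr X" "y + y' \<in> carr Y"
    using assms calculation by (auto simp: quasi_normed_def subspace_add)
  ultimately show ?thesis unfolding sum_carr_def by blast
qed

lemma quasi_concave_K_fun:
  assumes X: "quasi_normed X" and Y: "quasi_normed Y" and f: "f \<in> sum_carr X Y"
  shows "quasi_concave (\<lambda>t. K_fun t f X Y)"
  unfolding quasi_concave_def
proof (intro conjI allI impI)
  show "mono (\<lambda>t. K_fun t f X Y)"
  proof (rule monoI)
    fix s t :: real assume st: "s \<le> t"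
    show "K_fun s f X Y \<le> K_fun t f X Y"
      unfolding K_fun_def[of t]
    proof (rule Inf_greatest, safe)
      fix x y assume *: "x \<in> carr X" "y \<in> carr Y" "f = x + y"
      have "s * qnorm Y y \<le> t * qnorm Y y"
        using st * Y by (intro mult_right_mono qnorm_nonneg)
      then show "K_fun s (x + y) X Y \<le> ennreal (qnorm X x + t * qnorm Y y)"
        by (intro order_trans[OF K_fun_le[OF *(1,2)] ennreal_leI]) simp
    qed
  qed
  show "K_fun u f X Y < \<infinity>" for u
  proof -
    obtain x y where "f = x + y" "x \<in> carr X" "y \<in> carr Y" using f by (auto simp: sum_carr_def)
    then have "K_fun u f X Y \<le> ennreal (qnorm X x + u * qnorm Y y)" by (simp add: K_fun_le)
    then show ?thesis by (rule le_less_trans) simp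
  qed
  fix u t :: real assume u: "0 < u" and ut: "u \<le> t"
  have "ennreal (u / t) * K_fun t f X Y \<le> K_fun u f X Y"
    unfolding K_fun_def[of u]
  proof (rule Inf_greatest, safe)
    fix x y assume *: "x \<in> carr X" "y \<in> carr Y" "f = x + y"
    note nonneg = qnorm_nonneg[OF X *(1)] qnorm_nonneg[OF Y *(2)]
    have "(u / t) * qnorm X x \<le> 1 * qnorm X x"
      using u ut nonneg by (intro mult_right_mono) auto
    then have le: "u / t * (qnorm X x + t * qnorm Y y) \<le> qnorm X x + u * qnorm Y y"
      using u ut by (simp add: distrib_left)
    have "ennreal (u / t) * K_fun t (x + y) X Y \<le> ennreal (u / t) * ennreal (qnorm X x + t * qnorm Y y)"
      by (intro mult_left_mono K_fun_le *) auto
    also have "\<dots> = ennreal (u / t * (qnorm X x + t * qnorm Y y))"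
      using u ut by (intro ennreal_mult'[symmetric]) auto
    also have "\<dots> \<le> ennreal (qnorm X x + u * qnorm Y y)" by (intro ennreal_leI le)
    finally show "ennreal (u / t) * K_fun t (x + y) X Y \<le> ennreal (qnorm X x + u * qnorm Y y)" .
  qed
  then have "ennreal (t / u) * (ennreal (u / t) * K_fun t f X Y) \<le> ennreal (t / u) * K_fun u f X Y"
    by (rule mult_left_mono) simp
  moreover have "ennreal (t / u) * ennreal (u / t) = 1"
    using u ut by (subst ennreal_mult[symmetric]) auto
  ultimately show "K_fun t f X Y \<le> ennreal (t / u) * K_fun u f X Y"
    by (simp add: mult.assoc[symmetric])
qed

text \<open>
  Here compatibility is used: decompositions that are small in both spaces converge to \<open>0\<close> in the
  ambient Hausdorff space.
\<close>

lemma K_fun_eq_0_imp: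
  assumes comp: "compatible_couple X Y" and t: "0 < t" and 0: "K_fun t f X Y = 0"
  shows "f = 0"
proof (rule ccontr)
  assume "f \<noteq> 0"
  have X: "quasi_normed X" and Y: "quasi_normed Y" and eX: "continuously_embedded X" and eY:
      "continuously_embedded Y"
    using comp by (auto simp: compatible_couple_def)
  obtain U V where UV: "open U" "open V" "f \<in> U" "0 \<in> V" "U \<inter> V = {}"
    using hausdorff[OF \<open>f \<noteq> 0\<close>] by blast
  have "((\<lambda>p. fst p + snd p) \<longlongrightarrow> 0 + (0::'a)) (nhds 0 \<times>\<^sub>F nhds 0)"
    by (rule tendsto_add_Pair)
  then have "eventually (\<lambda>p. fst p + snd p \<in> V) (nhds (0::'a) \<times>\<^sub>F nhds 0)"
    using UV by (auto dest: topological_tendstoD)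
  then obtain P Q where PQ: "eventually P (nhds (0::'a))" "eventually Q (nhds (0::'a))"
    "\<And>x y. P x \<Longrightarrow> Q y \<Longrightarrow> x + y \<in> V"
    unfolding eventually_prod_filter by auto
  have small: "\<exists>d>0. \<forall>x\<in>carr Z. qnorm Z x < d \<longrightarrow> R x"
    if "quasi_normed Z" "continuously_embedded Z" "eventually R (nhds 0)" for Z and R :: "'a \<Rightarrow> bool"
  proof -
    obtain S where S: "open S" "0 \<in> S" "\<And>x. x \<in> S \<Longrightarrow> R x"
      using \<open>eventually R (nhds 0)\<close> by (auto simp: eventually_nhds)
    obtain d where "d > 0" "\<forall>y\<in>carr Z. qnorm Z (y - 0) < d \<longrightarrow> y \<in> S"
      using \<open>continuously_embedded Z\<close> quasi_normed_zero(1)[OF \<open>quasi_normed Z\<close>] S(1,2)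
      unfolding continuously_embedded_def by blast
    then show ?thesis using S(3) by auto
  qed
  obtain d where d: "d > 0" "\<And>x. x \<in> carr X \<Longrightarrow> qnorm X x < d \<Longrightarrow> P x"
    using small[OF X eX PQ(1)] by blast
  obtain d' where d': "d' > 0" "\<And>x. x \<in> carr Y \<Longrightarrow> qnorm Y x < d' \<Longrightarrow> Q x"
    using small[OF Y eY PQ(2)] by blast
  define e where "e = min d (t * d')"
  have "0 < e" using d d' t by (simp add: e_def)
  then have "K_fun t f X Y < ennreal e" using 0 by simp
  then obtain x y where xy: "x \<in> carr X" "y \<in> carr Y" "f = x + y"
      "ennreal (qnorm X x + t * qnorm Y y) < ennreal e"
    unfolding K_fun_def Inf_less_iff by blast
  note nonneg = qnorm_nonneg[OF X xy(1)] mult_nonneg_nonneg[OF less_imp_le[OF t] qnorm_nonneg[OF Y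
      xy(2)]]
  have less: "qnorm X x + t * qnorm Y y < e"
    using xy(4) nonneg by (subst (asm) ennreal_less_iff) auto
  have "qnorm X x < d" using less nonneg by (simp add: e_def)
  moreover have "t * qnorm Y y < t * d'" using less nonneg by (simp add: e_def)
  then have "qnorm Y y < d'" using t by simp
  ultimately have "x + y \<in> V" using xy d d' PQ(3) by blast
  then show False using xy(3) UV by blast
qed

text \<open>
  A multiplicative error is what keeps all later estimates homogeneous in \<open>f\<close>.  It is available even if
  \<open>K(t, f) = 0\<close>, because then \<open>f = 0\<close>.
\<close>

lemma near_optimal_decomposition:
  assumes comp: "compatible_couple X Y" and t: "0 < t" and f: "f \<in> sum_carr X Y"
  obtains x y where "x \<in> carr X" "y \<in> carr Y" "f = x + y" "ennreal (qnorm X x + t * qnorm Y y)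
      \<le> 2 * K_fun t f X Y"
proof (cases "K_fun t f X Y = 0")
  case True
  then have "f = 0" using comp t by (rule K_fun_eq_0_imp[rotated 2])
  moreover have "quasi_normed X" "quasi_normed Y" using comp by (auto simp: compatible_couple_def)
  ultimately show ?thesis using that[of 0 0] by (simp add: quasi_normed_zero)
next
  case False
  have "quasi_normed X" "quasi_normed Y" using comp by (auto simp: compatible_couple_def)
  then have "K_fun t f X Y < \<infinity>" using quasi_concave_K_fun[OF _ _ f] t by (auto simp: quasi_concave_def)
  then have "K_fun t f X Y + 0 < K_fun t f X Y + K_fun t f X Y"
    using False by (subst ennreal_add_left_cancel_less) (auto simp: zero_less_iff_neq_zero)
  then have "K_fun t f X Y < 2 * K_fun t f X Y"
    by (simp only: mult_2 add_0_right)
  then obtain x y where "x \<in> carr X" "y \<in> carr Y" "f = x + y"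
      "ennreal (qnorm X x + t * qnorm Y y) < 2 * K_fun t f X Y"
    unfolding K_fun_def[of t f X Y] Inf_less_iff by blast
  then show ?thesis using that by auto
qed

text \<open>
  Almost optimal decompositions of \<open>f\<close> and \<open>g\<close> add up to a decomposition of \<open>f + g\<close>.
\<close>

lemma K_fun_add_le:
  assumes comp: "compatible_couple X Y"
  shows "\<exists>C<\<infinity>. 1 \<le> C \<and> (\<forall>f\<in>sum_carr X Y. \<forall>g\<in>sum_carr X Y. \<forall>t>0.
    K_fun t (f + g) X Y \<le> C * (K_fun t f X Y + K_fun t g X Y))"
proof -
  have X: "quasi_normed X" and Y: "quasi_normed Y" using comp by (auto simp: compatible_couple_def)
  obtain A where A: "A \<ge> 1" "\<And>x y. x \<in> carr X \<Longrightarrow> y \<in> carr X \<Longrightarrow> qnorm X (x + y)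
      \<le> A * (qnorm X x + qnorm X y)"
    using quasi_triangle[OF X] by meson
  obtain B where B: "B \<ge> 1" "\<And>x y. x \<in> carr Y \<Longrightarrow> y \<in> carr Y \<Longrightarrow> qnorm Y (x + y)
      \<le> B * (qnorm Y x + qnorm Y y)"
    using quasi_triangle[OF Y] by meson
  define C where "C = max A B"
  have C: "C \<ge> 1" "A \<le> C" "B \<le> C" using A(1) by (auto simp: C_def)
  have "K_fun t (f + g) X Y \<le> (ennreal C * 2) * (K_fun t f X Y + K_fun t g X Y)"
    if f: "f \<in> sum_carr X Y" and g: "g \<in> sum_carr X Y" and t: "t > 0" for f g t
  proof -
    obtain x y where xy: "x \<in> carr X" "y \<in> carr Y" "f = x + y" "ennreal (qnorm X x + t * qnorm Y y)
        \<le> 2 * K_fun t f X Y"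
      using near_optimal_decomposition[OF comp t f] .
    obtain x' y' where xy': "x' \<in> carr X" "y' \<in> carr Y" "g = x' + y'"
        "ennreal (qnorm X x' + t * qnorm Y y') \<le> 2 * K_fun t g X Y"
      using near_optimal_decomposition[OF comp t g] .
    note nonneg = qnorm_nonneg[OF X xy(1)] qnorm_nonneg[OF Y xy(2)] qnorm_nonneg[OF X xy'(1)]
        qnorm_nonneg[OF Y xy'(2)]
    let ?p = "qnorm X x + t * qnorm Y y" and ?q = "qnorm X x' + t * qnorm Y y'"
    have "qnorm X (x + x') \<le> C * (qnorm X x + qnorm X x')"
      using A(2)[OF xy(1) xy'(1)] C nonneg by (meson add_nonneg_nonneg mult_right_mono order_trans)
    moreover have "qnorm Y (y + y') \<le> C * (qnorm Y y + qnorm Y y')"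
      using B(2)[OF xy(2) xy'(2)] C nonneg by (meson add_nonneg_nonneg mult_right_mono order_trans)
    then have "t * qnorm Y (y + y') \<le> t * (C * (qnorm Y y + qnorm Y y'))"
      using t by (intro mult_left_mono) auto
    ultimately have le: "qnorm X (x + x') + t * qnorm Y (y + y') \<le> C * (?p + ?q)"
      by (simp add: algebra_simps)
    have "f + g = (x + x') + (y + y')" by (simp add: xy xy' algebra_simps)
    moreover have "x + x' \<in> carr X" "y + y' \<in> carr Y"
      using X Y xy xy' by (auto simp: quasi_normed_def subspace_add)
    ultimately have "K_fun t (f + g) X Y \<le> ennreal (qnorm X (x + x') + t * qnorm Y (y + y'))"
      by (simp only: K_fun_le)
    also have "\<dots> \<le> ennreal (C * (?p + ?q))" by (intro ennreal_leI le)
    also have "\<dots> = ennreal C * (ennreal ?p + ennreal ?q)"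
      using nonneg C t by (simp add: ennreal_mult')
    also have "\<dots> \<le> ennreal C * (2 * K_fun t f X Y + 2 * K_fun t g X Y)"
      by (intro mult_left_mono add_mono xy xy') auto
    finally show ?thesis by (simp add: algebra_simps)
  qed
  moreover have "ennreal C * 2 < \<infinity>" by (simp add: ennreal_mult_less_top)
  moreover have "1 \<le> ennreal C * 2"
  proof -
    have "1 * 1 \<le> ennreal C * 2" using C(1) by (intro mult_mono) auto
    then show ?thesis by simp
  qed
  ultimately show ?thesis by blast
qed

lemma quasi_concave_cmult:
  assumes "quasi_concave k" "c < \<infinity>"
  shows "quasi_concave (\<lambda>u. c * k u)"
  unfolding quasi_concave_def
proof (intro conjI allI impI)
  show "mono (\<lambda>u. c * k u)" using assms by (auto simp: quasi_concave_def mono_def intro!: mult_left_mono)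
  show "c * k u < \<infinity>" if "u > 0" for u using assms that
      by (simp add: quasi_concave_def ennreal_mult_less_top)
  fix u t :: real assume "0 < u" "u \<le> t"
  then have "c * k t \<le> c * (ennreal (t / u) * k u)"
    using assms by (intro mult_left_mono) (auto simp: quasi_concave_def)
  then show "c * k t \<le> ennreal (t / u) * (c * k u)" by (simp add: mult.left_commute)
qed

lemma wnorm_haar:
  "wnorm \<theta> q b S F = haar_norm q S (\<lambda>u. ennreal (u powr (- \<theta>) * b u) * F u)"
proof -
  have "ennreal (u powr (- \<theta> - recip q) * b u)
      = ennreal (u powr (- recip q)) * ennreal (u powr (- \<theta>) * b u)" for u
  proof -
    have "u powr (- \<theta> - recip q) = u powr (- recip q) * u powr (- \<theta>)"
      by (simp add: powr_add[symmetric] add.commute)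
    then show ?thesis by (simp only: mult.assoc) (simp add: ennreal_mult')
  qed
  then show ?thesis unfolding wnorm_def haar_norm_def by (simp only: mult.assoc)
qed

text \<open>
  Restricting to the half-line matters: \<open>0 powr 0 = 0\<close>.
\<close>

lemma wnorm_zero_haar:
  assumes "0 < q" "S \<in> sets borel" "S \<subseteq> {0<..}"
  shows "wnorm 0 q b S F = haar_norm q S (\<lambda>u. ennreal (b u) * F u)"
  unfolding wnorm_haar using assms by (intro haar_norm_cong) (auto simp: subset_iff)

section \<open>The K-functional of the two interpolation spaces\<close>

locale limiting_couple = limiting_parameters q1 r1 r0 a1 b1 b0 \<theta>
  for q1 r1 r0 a1 b1 b0 \<theta> +
  fixes A0 A1 :: "'v::{real_vector, topological_ab_group_add, t2_space} qn_space"
  assumes compatible: "compatible_couple A0 A1"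
begin

definition K :: "'v \<Rightarrow> real \<Rightarrow> ennreal" where "K f u = K_fun u f A0 A1"

abbreviation "X \<equiv> interp A0 A1 \<theta> r0 b0"
abbreviation "Y \<equiv> interp_L A0 A1 1 r1 b1 q1 a1"

lemma A0: "quasi_normed A0" and A1: "quasi_normed A1"
  using compatible by (auto simp: compatible_couple_def)

lemma K_quasi_concave [intro]: "f \<in> sum_carr A0 A1 \<Longrightarrow> quasi_concave (K f)"
  using quasi_concave_K_fun[OF A0 A1] by (simp add: K_def[abs_def])

lemma K_measurable [intro]: "f \<in> sum_carr A0 A1 \<Longrightarrow> measurable_pos (K f)"
  by (rule quasi_concave_measurable[OF K_quasi_concave])

lemma X_on_eq: "wnorm \<theta> r0 b0 S (\<lambda>u. K_fun u f A0 A1) = X_on S (K f)"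
  by (simp add: wnorm_haar X_on_def X_weight_def K_def)

lemma Y_from_eq:
  assumes "0 \<le> t"
  shows "wnorm 0 r1 b1 {t<..} (\<lambda>s. wnorm 1 q1 a1 {t<..<s} (\<lambda>u. K_fun u f A0 A1)) = Y_from t (K f)"
  using assms r1 by (subst wnorm_zero_haar)
    (auto simp: wnorm_haar[of 1] Y_from_def inner_from_def inner_weight_def K_def simp del: powr_neg_one)

lemma Phi_eq: "wnorm 0 q1 a1 {0<..<s} (\<lambda>u. 1) = Phi s"
  using q1 by (subst wnorm_zero_haar) (auto simp: Phi_def)

lemma chi_eq:
  assumes "0 < t" shows "chi r1 b1 q1 a1 t = Chi t"
proof -
  have "wnorm 0 r1 b1 {t<..} (\<lambda>s. 1) = tail t"
    using assms r1 by (subst wnorm_zero_haar) (auto simp: tail_def)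
  moreover have "wnorm 0 r1 b1 {0<..<t} Phi = haar_norm r1 {0<..<t} (\<lambda>s. ennreal (b1 s) * Phi s)"
    using r1 by (intro wnorm_zero_haar) auto
  ultimately show ?thesis unfolding chi_def Phi_eq Chi_def by simp
qed

lemma rho_eq: "0 < t \<Longrightarrow> rho \<theta> b0 r1 b1 q1 a1 t = rho_val t"
  by (simp add: rho_def rho_val_def chi_eq chi_val_def)

lemma carr_X: "f \<in> carr X \<longleftrightarrow> f \<in> sum_carr A0 A1 \<and> X_on {0<..} (K f) < \<infinity>"
  and qnorm_X: "f \<in> carr X \<Longrightarrow> ennreal (qnorm X f) = X_on {0<..} (K f)"
  by (auto simp: interp_def space_with_norm_def X_on_eq)

lemma carr_Y: "f \<in> carr Y \<longleftrightarrow> f \<in> sum_carr A0 A1 \<and> Y_from 0 (K f) < \<infinity>"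
  and qnorm_Y: "f \<in> carr Y \<Longrightarrow> ennreal (qnorm Y f) = Y_from 0 (K f)"
  by (auto simp: interp_L_def space_with_norm_def Y_from_eq)

lemma ennreal_X_Y_norm:
  assumes "g \<in> carr X" "h \<in> carr Y" "0 < t"
  shows "ennreal (qnorm X g + rho_val t * qnorm Y h)
      = X_on {0<..} (K g) + ennreal (rho_val t) * Y_from 0 (K h)"
proof -
  have nonneg: "0 \<le> qnorm X g" "0 \<le> qnorm Y h"
    by (auto simp: interp_def interp_L_def space_with_norm_def)
  show ?thesis
    using nonneg rho_val_pos[OF assms(3)] qnorm_X[OF assms(1)] qnorm_Y[OF assms(2)]
    by (simp add: ennreal_mult)
qed

definition explicit_K :: "real \<Rightarrow> 'v \<Rightarrow> ennreal" where
  "explicit_K t f = X_on {0<..<t} (K f) + ennreal (rho_val t) * Y_from t (K f)"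

text \<open>
  The almost optimal decomposition of \<open>f\<close> at level \<open>t\<close> in \<open>(A0, A1)\<close> is admissible for \<open>(X, Y)\<close>
  once the right-hand side is finite.
\<close>

lemma upper_estimate:
  "\<exists>C<\<infinity>. \<forall>f\<in>sum_carr A0 A1. \<forall>t>0. explicit_K t f < \<infinity> \<longrightarrow> K_fun (rho_val t) f X Y \<le> C * explicit_K t f"
proof -
  obtain B where B: "B < \<infinity>" "1 \<le> B" "\<And>f g t. f \<in> sum_carr A0 A1 \<Longrightarrow> g \<in> sum_carr A0 A1 \<Longrightarrow> t > 0 \<Longrightarrow>
      K (f + g) t \<le> B * (K f t + K g t)"
    using K_fun_add_le[OF compatible] unfolding K_def by blast
  obtain C where C: "C < \<infinity>" "\<And>t k k0. t > 0 \<Longrightarrow> quasi_concave k \<Longrightarrow> measurable_pos k0 \<Longrightarrow>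
    \<forall>u>0. k0 u \<le> k (min u t) \<Longrightarrow> X_on {0<..} k0 \<le> C * X_on {0<..<t} k"
    using X_on_truncation_le by meson
  obtain D where D: "D < \<infinity>" "\<And>t k k1. t > 0 \<Longrightarrow> quasi_concave k \<Longrightarrow> measurable_pos k1 \<Longrightarrow>
    \<forall>u>0. u \<le> t \<longrightarrow> k1 u \<le> ennreal u * (k t * ennreal (1 / t)) \<Longrightarrow> \<forall>u>t. k1 u \<le> k u \<Longrightarrow>
    ennreal (rho_val t) * Y_from 0 k1 \<le> D * (X_on {0<..<t} k + ennreal (rho_val t) * Y_from t k)"
    using Y_from_truncation_le by meson
  \<comment> \<open>For \<open>u \<le> t\<close>, \<open>K(u, x) \<le> B (K(u, f) + K(u, - y))\<close> with last term at most \<open>2 K(u, f)\<close>;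
      symmetrically for \<open>y\<close> and \<open>u > t\<close>.\<close>
  define M where "M = B * 3"
  have M: "M < \<infinity>" using B(1) by (simp add: M_def ennreal_mult_less_top)
  have M2: "2 \<le> M"
  proof -
    have "1 * 2 \<le> B * 3" using B(2) by (intro mult_mono) auto
    then show ?thesis by (simp add: M_def)
  qed
  have "K_fun (rho_val t) f X Y \<le> ((C + D) * M) * explicit_K t f"
    if f: "f \<in> sum_carr A0 A1" and t: "t > 0" and fin: "explicit_K t f < \<infinity>" for f t
  proof -
    obtain x y where xy: "x \<in> carr A0" "y \<in> carr A1" "f = x + y"
        "ennreal (qnorm A0 x + t * qnorm A1 y) \<le> 2 * K f t"
      using near_optimal_decomposition[OF compatible t f] unfolding K_def by metis
    note nonneg = qnorm_nonneg[OF A0 xy(1)] qnorm_nonneg[OF A1 xy(2)]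
    have norm_x: "ennreal (qnorm A0 x) \<le> 2 * K f t"
      using nonneg t by (intro order_trans[OF ennreal_leI xy(4)]) simp
    have norm_y: "ennreal (u * qnorm A1 y) \<le> ennreal (u / t) * (2 * K f t)" if "u > 0" for u
    proof -
      have "ennreal (u * qnorm A1 y) = ennreal (u / t) * ennreal (t * qnorm A1 y)"
        using t nonneg that by (subst ennreal_mult[symmetric]) auto
      also have "\<dots> \<le> ennreal (u / t) * (2 * K f t)"
        using nonneg t by (intro mult_left_mono order_trans[OF ennreal_leI xy(4)]) auto
      finally show ?thesis .
    qed
    have sums: "x \<in> sum_carr A0 A1" "y \<in> sum_carr A0 A1" "- x \<in> sum_carr A0 A1" "- y \<in> sum_carr A0 A1"
      using xy quasi_normed_uminus[OF A0 xy(1)] quasi_normed_uminus[OF A1 xy(2)]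
      by (auto intro: sum_carr_left[OF A1] sum_carr_right[OF A0])
    note qc = K_quasi_concave[OF f]
    let ?k = "\<lambda>u. M * K f u"
    have qcM: "quasi_concave ?k" by (rule quasi_concave_cmult[OF qc M])
    have three: "B * (K f u + 2 * K f u) = M * K f u" for u
    proof -
      have "K f u + 2 * K f u = (1 + 2) * K f u" by (simp only: distrib_right mult_1)
      then show ?thesis by (simp add: M_def mult.assoc)
    qed
    have Kx: "\<forall>u>0. K x u \<le> ?k (min u t)"
    proof (intro allI impI)
      fix u :: real assume u: "u > 0"
      show "K x u \<le> ?k (min u t)"
      proof (cases "u \<le> t")
        case True
        have "K (- y) u \<le> ennreal (u * qnorm A1 y)"
          using K_fun_le_right[OF A0 quasi_normed_uminus(1)[OF A1 xy(2)], of u]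
              quasi_normed_uminus(2)[OF A1 xy(2)]
          by (simp add: K_def)
        also have "\<dots> \<le> ennreal (u / t) * (2 * K f t)" by (rule norm_y[OF u])
        also have "\<dots> \<le> ennreal (u / t) * (2 * (ennreal (t / u) * K f u))"
          using qc u True by (intro mult_left_mono) (auto simp: quasi_concave_def)
        also have "\<dots> = (ennreal (u / t) * ennreal (t / u)) * (2 * K f u)" by (simp add: mult_ac)
        also have "ennreal (u / t) * ennreal (t / u) = 1"
          using u t by (subst ennreal_mult[symmetric]) auto
        finally have "B * (K f u + K (- y) u) \<le> B * (K f u + 2 * K f u)"
          by (intro mult_left_mono add_left_mono) auto
        moreover have "K (f + - y) u \<le> B * (K f u + K (- y) u)"
          using f sums u by (intro B(3)) auto
        ultimately show ?thesis using True xy(3) three[of u] by (simp add: min_def)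
      next
        case False
        have "K x u \<le> ennreal (qnorm A0 x)" unfolding K_def by (rule K_fun_le_left[OF A1 xy(1)])
        also have "\<dots> \<le> 2 * K f t" by (rule norm_x)
        also have "\<dots> \<le> M * K f t" by (intro mult_right_mono M2) auto
        finally show ?thesis using False by (simp add: min_def)
      qed
    qed
    have Ky1: "\<forall>u>0. u \<le> t \<longrightarrow> K y u \<le> ennreal u * (?k t * ennreal (1 / t))"
    proof (intro allI impI)
      fix u :: real assume u: "u > 0"
      have "K y u \<le> ennreal (u * qnorm A1 y)" unfolding K_def by (rule K_fun_le_right[OF A0 xy(2)])
      also have "\<dots> \<le> ennreal (u / t) * (2 * K f t)" by (rule norm_y[OF u])
      also have "\<dots> \<le> ennreal (u / t) * (M * K f t)" by (intro mult_left_mono mult_right_mono M2) auto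
      also have "ennreal (u / t) = ennreal u * ennreal (1 / t)"
        using u t by (subst ennreal_mult[symmetric]) auto
      finally show "K y u \<le> ennreal u * (?k t * ennreal (1 / t))" by (simp add: mult_ac)
    qed
    have Ky2: "\<forall>u>t. K y u \<le> ?k u"
    proof (intro allI impI)
      fix u :: real assume u: "u > t"
      have "K (- x) u \<le> ennreal (qnorm A0 x)"
        using K_fun_le_left[OF A1 quasi_normed_uminus(1)[OF A0 xy(1)], of u]
            quasi_normed_uminus(2)[OF A0 xy(1)]
        by (simp add: K_def)
      also have "\<dots> \<le> 2 * K f t" by (rule norm_x)
      also have "\<dots> \<le> 2 * K f u"
        using qc u by (intro mult_left_mono) (auto simp: quasi_concave_def mono_def)
      finally have "B * (K f u + K (- x) u) \<le> B * (K f u + 2 * K f u)"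
        by (intro mult_left_mono add_left_mono) auto
      moreover have "K (f + - x) u \<le> B * (K f u + K (- x) u)"
        using f sums u t by (intro B(3)) auto
      ultimately show "K y u \<le> ?k u" using xy(3) three[of u] by simp
    qed
    have "X_on {0<..} (K x) \<le> C * X_on {0<..<t} ?k"
      by (rule C(2)[OF t qcM K_measurable[OF sums(1)] Kx])
    also have "\<dots> \<le> C * (M * X_on {0<..<t} (K f))"
      using K_measurable[OF f] by (intro mult_left_mono X_on_cmult_le) auto
    also have "\<dots> \<le> C * (M * explicit_K t f)"
      by (intro mult_left_mono) (auto simp: explicit_K_def)
    finally have Xx: "X_on {0<..} (K x) \<le> C * (M * explicit_K t f)" .
    have "ennreal (rho_val t) * Y_from 0 (K y)
        \<le> D * (X_on {0<..<t} ?k + ennreal (rho_val t) * Y_from t ?k)"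
      by (rule D(2)[OF t qcM K_measurable[OF sums(2)] Ky1 Ky2])
    also have "\<dots> \<le> D * (M * X_on {0<..<t} (K f) + ennreal (rho_val t) * (M * Y_from t (K f)))"
      using K_measurable[OF f] t by (intro mult_left_mono add_mono X_on_cmult_le Y_from_cmult_le) auto
    also have "\<dots> = D * (M * explicit_K t f)" by (simp add: explicit_K_def algebra_simps)
    finally have Yy: "ennreal (rho_val t) * Y_from 0 (K y) \<le> D * (M * explicit_K t f)" .
    have "C * (M * explicit_K t f) < \<infinity>" "D * (M * explicit_K t f) < \<infinity>"
      using C(1) D(1) M fin by (simp_all add: ennreal_mult_less_top)
    note finite = le_less_trans[OF Xx this(1)] le_less_trans[OF Yy this(2)]
    have "x \<in> carr X" unfolding carr_X using sums finite(1) by simp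
    moreover have "ennreal (rho_val t) * Y_from 0 (K y) < \<infinity>" by (rule finite(2))
    then have "y \<in> carr Y"
      unfolding carr_Y using sums rho_val_pos[OF t] by
          (auto simp: ennreal_mult_less_top ennreal_eq_0_iff)
    ultimately have "K_fun (rho_val t) f X Y \<le> X_on {0<..} (K x) + ennreal (rho_val t) * Y_from 0 (K y)"
      using K_fun_le[of x X y Y "rho_val t"] t by (simp add: xy(3) ennreal_X_Y_norm)
    also have "\<dots> \<le> C * (M * explicit_K t f) + D * (M * explicit_K t f)" by (intro add_mono Xx Yy)
    finally show ?thesis by (simp add: algebra_simps)
  qed
  moreover have "(C + D) * M < \<infinity>" using C(1) D(1) M by (simp add: ennreal_mult_less_top)
  ultimately show ?thesis by blast
qed

text \<open>
  Each of the two terms is split along \<open>f = g + h\<close>; monotonicity in the domain handles \<open>g\<close> in the first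
  and \<open>h\<close> in the second term, the cross term lemmas handle the rest.
\<close>

lemma lower_estimate:
  "\<exists>C<\<infinity>. \<forall>g\<in>carr X. \<forall>h\<in>carr Y. \<forall>t>0. explicit_K t (g + h)
      \<le> C * ennreal (qnorm X g + rho_val t * qnorm Y h)"
proof -
  obtain B where B: "B < \<infinity>" "\<And>f g t. f \<in> sum_carr A0 A1 \<Longrightarrow> g \<in> sum_carr A0 A1 \<Longrightarrow> t > 0 \<Longrightarrow>
      K (f + g) t \<le> B * (K f t + K g t)"
    using K_fun_add_le[OF compatible] unfolding K_def by blast
  obtain C where C: "C < \<infinity>" "\<And>S k k'. S \<in> sets borel \<Longrightarrow> S \<subseteq> {0<..} \<Longrightarrow> measurable_pos k
      \<Longrightarrow> measurable_pos k' \<Longrightarrow>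
    X_on S (\<lambda>u. k u + k' u) \<le> C * (X_on S k + X_on S k')"
    using X_on_add_le by meson
  obtain D where D: "D < \<infinity>" "\<And>t k k'. t \<ge> 0 \<Longrightarrow> measurable_pos k \<Longrightarrow> measurable_pos k' \<Longrightarrow>
    Y_from t (\<lambda>u. k u + k' u) \<le> D * (Y_from t k + Y_from t k')"
    using Y_from_add_le by meson
  obtain E where E: "E < \<infinity>" "\<And>t h. t > 0 \<Longrightarrow> quasi_concave h \<Longrightarrow> X_on {0<..<t} h
      \<le> E * (ennreal (rho_val t) * Y_from 0 h)"
    using X_on_le_Y_from by meson
  obtain G where G: "G < \<infinity>" "\<And>t g. t > 0 \<Longrightarrow> quasi_concave g \<Longrightarrow> ennreal (rho_val t) * Y_from t g
      \<le> G * X_on {0<..} g"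
    using Y_from_le_X_on by meson
  have "explicit_K t (g + h) \<le> (B * C * (1 + E) + B * D * (1 + G)) * ennreal (qnorm X g + rho_val t
      * qnorm Y h)"
    if g: "g \<in> carr X" and h: "h \<in> carr Y" and t: "t > 0" for g h t
  proof -
    have sums: "g \<in> sum_carr A0 A1" "h \<in> sum_carr A0 A1" using g h by (auto simp: carr_X carr_Y)
    have gh: "g + h \<in> sum_carr A0 A1" by (rule sum_carr_add[OF A0 A1 sums])
    note meas = K_measurable[OF sums(1)] K_measurable[OF sums(2)] K_measurable[OF gh]
    define N where "N = X_on {0<..} (K g) + ennreal (rho_val t) * Y_from 0 (K h)"
    have N: "X_on {0<..} (K g) \<le> N" "ennreal (rho_val t) * Y_from 0 (K h) \<le> N"
      by (auto simp: N_def)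
    let ?s = "\<lambda>u. K g u + K h u"
    have ms: "measurable_pos ?s" using meas by auto
    have le: "K (g + h) u \<le> B * ?s u" if "u > 0" for u
      by (rule B(2)[OF sums that])
    have "X_on {0<..<t} (K (g + h)) \<le> X_on {0<..<t} (\<lambda>u. B * ?s u)"
      using le meas by (intro X_on_mono) auto
    also have "\<dots> \<le> B * X_on {0<..<t} ?s"
      using ms by (intro X_on_cmult_le) auto
    also have "\<dots> \<le> B * (C * (X_on {0<..<t} (K g) + X_on {0<..<t} (K h)))"
      using meas by (intro mult_left_mono C) auto
    also have "\<dots> \<le> B * (C * (X_on {0<..} (K g) + E * (ennreal (rho_val t) * Y_from 0 (K h))))"
      using meas t sums by (intro mult_left_mono add_mono E X_on_mono) auto
    also have "\<dots> \<le> B * (C * (N + E * N))"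
      by (intro mult_left_mono add_mono N) auto
    also have "\<dots> = B * C * (1 + E) * N" by (simp add: algebra_simps)
    finally have 1: "X_on {0<..<t} (K (g + h)) \<le> B * C * (1 + E) * N" .
    have "Y_from t (K (g + h)) \<le> Y_from t (\<lambda>u. B * ?s u)"
      using le meas t by (intro Y_from_mono) auto
    also have "\<dots> \<le> B * Y_from t ?s"
      using ms t by (intro Y_from_cmult_le) auto
    also have "\<dots> \<le> B * (D * (Y_from t (K g) + Y_from t (K h)))"
      using meas t by (intro mult_left_mono D) auto
    finally have "ennreal (rho_val t) * Y_from t (K (g + h))
        \<le> ennreal (rho_val t) * (B * (D * (Y_from t (K g) + Y_from t (K h))))"
      by (rule mult_left_mono) simp
    also have "\<dots> = B * (D * (ennreal (rho_val t) * Y_from t (K g) + ennreal (rho_val t) * Y_from t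
        (K h)))"
      by (simp add: algebra_simps)
    also have "\<dots> \<le> B * (D * (G * X_on {0<..} (K g) + ennreal (rho_val t) * Y_from 0 (K h)))"
      using meas t sums by (intro mult_left_mono add_mono G Y_from_mono) auto
    also have "\<dots> \<le> B * (D * (G * N + N))"
      by (intro mult_left_mono add_mono N) auto
    also have "\<dots> = B * D * (1 + G) * N" by (simp add: algebra_simps)
    finally have 2: "ennreal (rho_val t) * Y_from t (K (g + h)) \<le> B * D * (1 + G) * N" .
    have "explicit_K t (g + h) \<le> B * C * (1 + E) * N + B * D * (1 + G) * N"
      unfolding explicit_K_def by (intro add_mono 1 2)
    then show ?thesis
      unfolding ennreal_X_Y_norm[OF g h t] N_def[symmetric] by (simp add: distrib_right)
  qed
  moreover have "B * C * (1 + E) + B * D * (1 + G) < \<infinity>"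
    using B(1) C(1) D(1) E(1) G(1) by (simp add: ennreal_mult_less_top)
  ultimately show ?thesis by blast
qed

lemma K_fun_equivalent_explicit_K:
  "\<exists>C>0. \<forall>f\<in>sum_carr X Y. \<forall>t>0.
     ennreal (1 / C) * explicit_K t f \<le> K_fun (rho_val t) f X Y \<and> K_fun (rho_val t) f X Y
         \<le> ennreal C * explicit_K t f"
proof -
  obtain U where U: "U < \<infinity>" "\<And>f t. f \<in> sum_carr A0 A1 \<Longrightarrow> t > 0 \<Longrightarrow> explicit_K t f < \<infinity>
      \<Longrightarrow> K_fun (rho_val t) f X Y \<le> U * explicit_K t f"
    using upper_estimate by meson
  obtain L where L: "L < \<infinity>" "\<And>g h t. g \<in> carr X \<Longrightarrow> h \<in> carr Y \<Longrightarrow> t > 0 \<Longrightarrow>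
      explicit_K t (g + h) \<le> L * ennreal (qnorm X g + rho_val t * qnorm Y h)"
    using lower_estimate by meson
  define C where "C = enn2real U + enn2real L + 1"
  have C: "C > 0" by (simp add: C_def add_nonneg_pos)
  have "ennreal (enn2real U) \<le> ennreal C" "ennreal (enn2real L) \<le> ennreal C"
    by (intro ennreal_leI; simp add: C_def)+
  then have UC: "U \<le> ennreal C" and LC: "L \<le> ennreal C" using U(1) L(1) by simp_all
  have inv: "ennreal (1 / C) * ennreal C = 1"
    using C by (subst ennreal_mult[symmetric]) auto
  have "ennreal (1 / C) * explicit_K t f \<le> K_fun (rho_val t) f X Y" if t: "t > 0" for f t
    unfolding K_fun_def
  proof (rule Inf_greatest, safe)
    fix g h assume *: "g \<in> carr X" "h \<in> carr Y" "f = g + h"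
    let ?n = "ennreal (qnorm X g + rho_val t * qnorm Y h)"
    have "ennreal (1 / C) * explicit_K t (g + h) \<le> ennreal (1 / C) * (L * ?n)"
      by (intro mult_left_mono L * t) auto
    also have "\<dots> \<le> ennreal (1 / C) * (ennreal C * ?n)"
      by (intro mult_left_mono mult_right_mono LC) auto
    also have "\<dots> = ?n" by (simp only: mult.assoc[symmetric] inv mult_1)
    finally show "ennreal (1 / C) * explicit_K t (g + h) \<le> ?n" .
  qed
  moreover have "K_fun (rho_val t) f X Y \<le> ennreal C * explicit_K t f" if f:
      "f \<in> sum_carr X Y" and t: "t > 0" for f t
  proof (cases "explicit_K t f < \<infinity>")
    case True
    have "f \<in> sum_carr A0 A1"
      using f sum_carr_add[OF A0 A1] unfolding sum_carr_def[of X Y] by (auto simp: carr_X carr_Y)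
    then have "K_fun (rho_val t) f X Y \<le> U * explicit_K t f" using t True by (rule U(2))
    also have "\<dots> \<le> ennreal C * explicit_K t f" by (intro mult_right_mono UC) auto
    finally show ?thesis .
  next
    case False
    then have "explicit_K t f = \<infinity>" by (simp add: less_top[symmetric])
    then show ?thesis using C by (simp add: ennreal_mult_top ennreal_eq_0_iff)
  qed
  ultimately show ?thesis using C by blast
qed

end

theorem theorem28:
  fixes A0 A1 :: "'v::{real_vector, topological_ab_group_add, t2_space} qn_space"
    and q1 r1 r0 :: ennreal
    and a1 b1 b0 :: "real \<Rightarrow> real"
    and \<theta>0 :: real
  assumes "compatible_couple A0 A1" and "quasi_banach A0" and "quasi_banach A1"
    and "carr A0 \<inter> carr A1 \<noteq> {0}"
    and "0 < q1" and "0 < r1" and "a1 \<in> SV" and "b1 \<in> SV"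
    and "wnorm 0 r1 b1 {1<..} (\<lambda>s. 1) < \<infinity>"
    and "wnorm 0 r1 b1 {0<..<1} (\<lambda>s. wnorm 0 q1 a1 {0<..<s} (\<lambda>u. 1)) < \<infinity>"
    and "0 < \<theta>0" and "\<theta>0 < 1" and "0 < r0" and "b0 \<in> SV"
    and "carr (interp A0 A1 \<theta>0 r0 b0) \<noteq> {0}"
    and "carr (interp_L A0 A1 1 r1 b1 q1 a1) \<noteq> {0}"
  shows "\<exists>C>0. \<forall>f \<in> sum_carr (interp A0 A1 \<theta>0 r0 b0) (interp_L A0 A1 1 r1 b1 q1 a1). \<forall>t>0.
    let \<rho> = rho \<theta>0 b0 r1 b1 q1 a1 t;
        lhs = K_fun \<rho> f (interp A0 A1 \<theta>0 r0 b0) (interp_L A0 A1 1 r1 b1 q1 a1);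
        rhs = wnorm \<theta>0 r0 b0 {0<..<t} (\<lambda>u. K_fun u f A0 A1) +
              ennreal \<rho> * wnorm 0 r1 b1 {t<..}
                (\<lambda>s. wnorm 1 q1 a1 {t<..<s} (\<lambda>u. K_fun u f A0 A1))
    in ennreal (1 / C) * rhs \<le> lhs \<and> lhs \<le> ennreal C * rhs"
proof -
  have inner: "wnorm 0 q1 a1 {0<..<s} (\<lambda>u. 1) = haar_norm q1 {0<..<s} (\<lambda>u. ennreal (a1 u))" for s
    using assms(5) by (subst wnorm_zero_haar) auto
  have tail: "haar_norm r1 {1<..} (\<lambda>s. ennreal (b1 s)) < \<infinity>"
    using assms(6,9) by (subst (asm) wnorm_zero_haar) auto
  have head: "haar_norm r1 {0<..<1}
      (\<lambda>s. ennreal (b1 s) * haar_norm q1 {0<..<s} (\<lambda>u. ennreal (a1 u))) < \<infinity>"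
    using assms(6,10) unfolding inner by (subst (asm) wnorm_zero_haar) auto
  interpret limiting_couple q1 r1 r0 a1 b1 b0 \<theta>0 A0 A1
    by unfold_locales (use assms tail head in auto)
  have "explicit_K t f = wnorm \<theta>0 r0 b0 {0<..<t} (\<lambda>u. K_fun u f A0 A1) + ennreal (rho_val t) *
      wnorm 0 r1 b1 {t<..} (\<lambda>s. wnorm 1 q1 a1 {t<..<s} (\<lambda>u. K_fun u f A0 A1))" if "t > 0" for t f
    using that by (simp add: explicit_K_def X_on_eq Y_from_eq)
  then show ?thesis
    using K_fun_equivalent_explicit_K by (simp add: Let_def rho_eq)
qed

end
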